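(* Let $n \ge 0$ be an integer and $\theta,\varphi \in [0,\pi]$. Then, with all integrations taken over $(u,v)\in[-1,1]^2$: (i) If $\alpha,\beta \ge -1/2$, then $$ \mathfrak{C}_n^{\alpha,\beta} P_n^{\alpha,\beta}(\cos\theta) P_n^{\alpha,\beta}(\cos\varphi) = \iint \Phi_{2n}^{\alpha+\beta+1/2}(\theta,\varphi,u,v)\, d\Pi_{\alpha}(u) \, d\Pi_{\beta}(v). $$ (ii) If $-1 < \beta < -1/2 \le \alpha$, then $$ \begin{aligned} \mathfrak{C}_n^{\alpha,\beta} P_n^{\alpha,\beta}(\cos\theta) P_n^{\alpha,\beta}(\cos\varphi) = \iint \Big\{ & -2(\alpha+\beta+5/2) \cos\frac{\theta}2\cos\frac{\varphi}2\, \Phi_{2n-1}^{\alpha+\beta+3/2}(\theta,\varphi,u,v)\, d\Pi_{\alpha}(u)\, \Pi_{\beta}(v)\, dv \\ & + \Phi_{2n}^{\alpha+\beta+1/2}(\theta,\varphi,u,v) \, d\Pi_{\alpha}(u)\, d\Pi_{-1/2}(v) \Big\}. \end{aligned} $$ (iii) If $-1 < \alpha < -1/2 \le \beta$, then $$ \begin{aligned} \mathfrak{C}_n^{\alpha,\beta} P_n^{\alpha,\beta}(\cos\theta) P_n^{\alpha,\beta}(\cos\varphi) = \iint \Big\{ & -2(\alpha+\beta+5/2) \sin\frac{\theta}2\sin\frac{\varphi}2\, \Phi_{2n-1}^{\alpha+\beta+3/2}(\theta,\varphi,u,v)\, \Pi_{\alpha}(u)\, du \, d\Pi_{\beta}(v)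 \\ & + \Phi_{2n}^{\alpha+\beta+1/2}(\theta,\varphi,u,v) \, d\Pi_{-1/2}(u)\, d\Pi_{\beta}(v) \Big\}. \end{aligned} $$ (iv) If $-1 < \alpha,\beta < -1/2$, then $$ \begin{aligned} \mathfrak{C}_n^{\alpha,\beta} P_n^{\alpha,\beta}(\cos\theta) & P_n^{\alpha,\beta}(\cos\varphi)\\ = \iint \Big\{ & (\alpha+\beta+5/2)(\alpha+\beta+7/2)\sin\theta\sin\varphi \, \Phi_{2n-2}^{\alpha+\beta+5/2}(\theta,\varphi,u,v)\, \Pi_{\alpha}(u)\, du \, \Pi_{\beta}(v)\, dv \\ & - 2(\alpha+\beta+5/2) \sin\frac{\theta}2\sin\frac{\varphi}2\, \Phi_{2n-1}^{\alpha+\beta+3/2}(\theta,\varphi,u,v)\, \Pi_{\alpha}(u)\, du \, d\Pi_{-1/2}(v) \\ & -2(\alpha+\beta+5/2) \cos\frac{\theta}2\cos\frac{\varphi}2\, \Phi_{2n-1}^{\alpha+\beta+3/2}(\theta,\varphi,u,v)\, d\Pi_{-1/2}(u)\, \Pi_{\beta}(v)\, dv \\ & + \Phi_{2n}^{\alpha+\beta+1/2}(\theta,\varphi,u,v)\, d\Pi_{-1/2}(u)\, d\Pi_{-1/2}(v) \Big\}. \end{aligned} $$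
   Context: Here $\alpha,\beta$ are real. Jacobi polynomials, for arbitrary parameters $\alpha,\beta\in\mathbb{C}$, are $$ P_n^{\alpha,\beta}(x) = \frac{1}{n!}\sum_{k=0}^n \binom{n}{k} (n+\alpha+\beta+1)_k\, (\alpha+k+1)_{n-k}\, \Big(\frac{x-1}2\Big)^k, \qquad n\ge 0, $$ with $(a)_0=1$, $(a)_k=a(a+1)\cdots(a+k-1)$ for $k\ge 1$; write $P_n^\lambda := P_n^{\lambda,\lambda}$. For $\alpha,\beta>-1$, $$ \mathfrak{C}_n^{\alpha,\beta} = \frac{\Gamma(\alpha+1)\Gamma(\beta+1)(2n+\alpha+\beta+1)\Gamma(n+\alpha+\beta+1)\Gamma(n+1)}{\sqrt{\pi}\,\Gamma(\alpha+\beta+5/2)\Gamma(n+\alpha+1)\Gamma(n+\beta+1)} \ (n\ge 1), \qquad \mathfrak{C}_0^{\alpha,\beta} = \frac{\Gamma(\alpha+\beta+2)}{\sqrt{\pi}\,\Gamma(\alpha+\beta+5/2)}. $$ Further, $$ \mathfrak{D}_k^{\lambda} = \frac{(2k+2\lambda+1)\Gamma(k+2\lambda+1)}{2^{2\lambda+1}\Gamma(\lambda+2)\Gamma(k+\lambda+1)} \ (k\ge 1), \qquad \mathfrak{D}_0^\lambda = \frac{\Gamma(\lambda+3/2)}{\sqrt{\pi}\,\Gamma(\lambda+2)}, $$ considered for $\lambda>-1$ and all $k\ge 0$, and also for $\lambda>-3/2$ when $k$ is even (the formulas being understood by analytic continuation in $\lambda$). Define, for $k\ge 0$, $$ \Phi_k^{\lambda}(\theta,\varphi,u,v)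 := \mathfrak{D}_k^{\lambda}\, P_{k}^{\lambda}\Big(u \sin\frac{\theta}2\sin\frac{\varphi}2 + v\cos\frac{\theta}2\cos\frac{\varphi}2\Big), $$ and $\Phi_k^\lambda\equiv 0$ for $k<0$. For $\alpha>-1$, $\alpha\ne -1/2$, $$ \Pi_{\alpha}(u) = \frac{\Gamma(\alpha+1)}{\sqrt{\pi}\, \Gamma(\alpha+1/2)} \int_0^{u} (1-w^2)^{\alpha-1/2}\, dw, \qquad -1<u<1 . $$ For $\alpha>-1/2$, $d\Pi_\alpha$ is the probability measure on $[-1,1]$ with density $\Pi_\alpha'$; $d\Pi_{-1/2}:=\frac12(\delta_{-1}+\delta_1)$, with $\delta_{\pm1}$ the unit point mass at $\pm1$. For $\alpha\in(-1,-1/2)$ the function $\Pi_\alpha$ is integrable on $[-1,1]$, and $\Pi_\alpha(u)\,du$ denotes the corresponding signed measure. *)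

theory Defs
  imports "HOL-Analysis.Analysis"
begin

definition jacobi_poly :: "nat \<Rightarrow> 'a::field_char_0 \<Rightarrow> 'a \<Rightarrow> 'a \<Rightarrow> 'a" where
  "jacobi_poly n \<alpha> \<beta> x =
     (1 / fact n) * (\<Sum>k\<le>n. of_nat (n choose k) * pochhammer (of_nat n + \<alpha> + \<beta> + 1) k
        * pochhammer (\<alpha> + of_nat k + 1) (n - k) * ((x - 1) / 2) ^ k)"

definition C_const :: "nat \<Rightarrow> real \<Rightarrow> real \<Rightarrow> real" where
  "C_const n \<alpha> \<beta> =
     (if n = 0 then Gamma (\<alpha> + \<beta> + 2) / (sqrt pi * Gamma (\<alpha> + \<beta> + 5/2))
      else Gamma (\<alpha> + 1) * Gamma (\<beta> + 1) * (2 * real n + \<alpha> + \<beta> + 1)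
             * Gamma (real n + \<alpha> + \<beta> + 1) * Gamma (real n + 1)
           / (sqrt pi * Gamma (\<alpha> + \<beta> + 5/2) * Gamma (real n + \<alpha> + 1) * Gamma (real n + \<beta> + 1)))"

text \<open>
  No explicit analytic continuation in \<open>\<lambda>\<close> is needed below: for \<open>\<lambda> > -1\<close>, and also for
  \<open>\<lambda> > -3/2\<close> with \<open>k\<close> even, every argument of \<open>Gamma\<close> is positive.
\<close>

definition D_const :: "nat \<Rightarrow> real \<Rightarrow> real" where
  "D_const k l =
     (if k = 0 then Gamma (l + 3/2) / (sqrt pi * Gamma (l + 2))
      else (2 * real k + 2 * l + 1) * Gamma (real k + 2 * l + 1)
           / (2 powr (2 * l + 1) * Gamma (l + 2) * Gamma (real k + l + 1)))"

definition Phi :: "int \<Rightarrow> real \<Rightarrow> real \<Rightarrow> real \<Rightarrow> real \<Rightarrow> real \<Rightarrow> real" where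
  "Phi k l \<theta> \<phi> u v =
     (if k < 0 then 0
      else D_const (nat k) l
           * jacobi_poly (nat k) l l (u * sin (\<theta>/2) * sin (\<phi>/2) + v * cos (\<theta>/2) * cos (\<phi>/2)))"

text \<open>
  The interval integral is oriented, so \<open>Pi_fun \<alpha>\<close> is odd. It is only meaningful for
  \<open>\<alpha> > -1\<close>, \<open>\<alpha> \<noteq> -1/2\<close> and \<open>-1 < u < 1\<close>.
\<close>

definition Pi_fun :: "real \<Rightarrow> real \<Rightarrow> real" where
  "Pi_fun \<alpha> u =
     Gamma (\<alpha> + 1) / (sqrt pi * Gamma (\<alpha> + 1/2)) * (LBINT w=0..u. (1 - w\<^sup>2) powr (\<alpha> - 1/2))"

text \<open>
  All measures live on the space \<open>[-1,1]\<close> with its Borel sets. The signed measure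
  \<open>\<Pi>\<^sub>\<alpha>(u) du\<close> is represented by integrating against \<open>leb_I\<close> with the factor
  \<open>Pi_fun \<alpha> u\<close> in the integrand; the values of \<open>Pi_fun \<alpha>\<close> at \<open>1\<close> and \<open>-1\<close> are irrelevant.
\<close>

definition leb_I :: "real measure" where
  "leb_I = restrict_space lborel {-1..1}"

definition half_deltas :: "real measure" where
  "half_deltas = measure_of {-1..1} (sets (restrict_space borel {-1..1}))
     (\<lambda>A. (indicator A (-1) + indicator A 1) / 2)"

text \<open>Meaningful for \<open>\<alpha> \<ge> -1/2\<close>.\<close>

definition dPi :: "real \<Rightarrow> real measure" where
  "dPi \<alpha> =
     (if \<alpha> = -1/2 then half_deltas
      else density leb_I (\<lambda>u. ennreal (indicator {-1<..<1} u * deriv (Pi_fun \<alpha>) u)))"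

text \<open>\<open>measure_of\<close> yields the null measure when applied to a set function that is not a measure;
  the following confirms that this does not happen here.\<close>

lemma emeasure_half_deltas:
  assumes "A \<in> sets (restrict_space borel {-1..1::real})"
  shows "emeasure half_deltas A = (indicator A (-1) + indicator A 1) / 2"
proof -
  let ?M = "restrict_space borel {-1..1::real}"
  let ?\<mu> = "\<lambda>A. (indicator A (-1) + indicator A (1::real)) / 2 :: ennreal"
  have sp: "space ?M = {-1..1}"
    by (simp add: space_restrict_space)
  have "sigma_algebra {-1..1} (sets ?M)"
    using sets.sigma_algebra_axioms[of ?M] sp by simp
  moreover have "positive (sets ?M) ?\<mu>"
    by (simp add: positive_def)
  moreover have "countably_additive (sets ?M) ?\<mu>"
  proof (rule countably_additiveI)
    fix F :: "nat \<Rightarrow> real set"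
    assume "disjoint_family F"
    then have "(\<Sum>i. indicator (F i) x :: ennreal) = indicator (\<Union>i. F i) x" for x
      by (rule suminf_indicator)
    then show "(\<Sum>i. ?\<mu> (F i)) = ?\<mu> (\<Union>i. F i)"
      by (simp add: divide_ennreal_def suminf_add[symmetric])
  qed
  ultimately show ?thesis
    unfolding half_deltas_def using assms by (rule emeasure_measure_of_sigma)
qed

end

theory Submission
  imports Defs "HOL-Computational_Algebra.Polynomial"
begin

text \<open>
  Put \<open>S = sin (\<theta>/2) sin (\<phi>/2)\<close>, \<open>T = cos (\<theta>/2) cos (\<phi>/2)\<close>, \<open>s = sin\<^sup>2 (\<theta>/2)\<close> and
  \<open>t = sin\<^sup>2 (\<phi>/2)\<close>, so that \<open>cos \<theta> = 1 - 2 s\<close>, \<open>S\<^sup>2 = s t\<close> and \<open>T\<^sup>2 = (1 - s) (1 - t)\<close>. All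
  integrands are polynomials in \<open>u S + v T\<close>, times the densities of the measures, so each integral
  depends on the measures only through their moments.

  For \<open>\<alpha> \<ge> -1/2\<close> the odd moments of \<open>dPi \<alpha>\<close> vanish and the moment of order \<open>2 j\<close> is
  \<open>(1/2)\<^sub>j / (\<alpha> + 1)\<^sub>j\<close> (lemma \<open>has_moments_dPi\<close>). These numbers, \<open>Pi_moment \<alpha>\<close>, make sense for all
  \<open>\<alpha> > -1\<close>, and for \<open>\<alpha> < -1/2\<close> the moments of \<open>Pi_fun \<alpha>\<close> are what integration by parts
  predicts: \<open>k\<close> times the moment of order \<open>k - 1\<close> is the \<open>k\<close>-th moment of the two half unit masses
  minus \<open>Pi_moment \<alpha> k\<close> (lemma \<open>has_moments_Pi_fun\<close>). Differentiating the polynomial \<open>Phi_poly\<close>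
  behind \<open>Phi\<close> lowers its index and raises its parameter (lemma \<open>pderiv_Phi_poly\<close>). The four cases
  are therefore one and the same identity between polynomials, with no, one or two integrations by
  parts undone: the product of the two Jacobi polynomials, times its constant, results from applying the moments
  \<open>Pi_moment \<alpha>\<close> in \<open>u\<close> and \<open>Pi_moment \<beta>\<close> in \<open>v\<close> to \<open>Phi_poly (2 n)\<close>
  (lemma \<open>product_formula_moments\<close>).

  To prove that identity, write the ultraspherical polynomial of degree \<open>2 n\<close> as a hypergeometric
  polynomial in the square of its argument (lemma \<open>hyp_poly_quadratic\<close>). Multiplying the moments
  with the binomial coefficients of \<open>(u S + v T)\<^sup>2\<^sup>j\<close> leaves the bilinear sum of Bateman
  (lemma \<open>bateman_product_formula\<close>), a combination of the polynomials
  \<open>g\<^sub>j = \<Sum>i\<le>j. (s t)\<^sup>i / (i! (\<alpha> + 1)\<^sub>i) * ((1 - s) (1 - t))\<^sup>j\<^sup>-\<^sup>i / ((j - i)! (\<beta> + 1)\<^sub>j\<^sub>-\<^sub>i)\<close>.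
  For fixed \<open>t\<close> the Jacobi operator in \<open>s\<close> maps \<open>g\<^sub>j\<close> to \<open>g\<^sub>j\<^sub>-\<^sub>1 - j (j + \<alpha> + \<beta> + 1) g\<^sub>j\<close>, so the
  coefficients \<open>(-n)\<^sub>j (n + \<alpha> + \<beta> + 1)\<^sub>j\<close> turn the sum into an eigenfunction. Polynomial
  eigenfunctions of degree at most \<open>n\<close> are unique up to scaling (lemma \<open>jacobi_op_eigen_unique\<close>),
  and the value at \<open>s = 0\<close> identifies the factor.
\<close>

section \<open>Polynomial eigenfunctions of the Jacobi operator\<close>

text \<open>
  The quadratic coefficient has leading coefficient \<open>-1\<close>, so this covers the Jacobi equation
  both in the variable \<open>s \<in> [0, 1]\<close> (\<open>a = 0\<close>, \<open>b = 1\<close>) and in the variable \<open>z \<in> [-1, 1]\<close>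
  (\<open>a = 1\<close>, \<open>b = 0\<close>).
\<close>

definition jacobi_op :: "real \<Rightarrow> real \<Rightarrow> real \<Rightarrow> real \<Rightarrow> real poly \<Rightarrow> real poly" where
  "jacobi_op a b p q y = [:a, b, -1:] * pderiv (pderiv y) + [:p, -q:] * pderiv y"

lemma jacobi_op_smult: "jacobi_op a b p q (smult c y) = smult c (jacobi_op a b p q y)"
  by (simp add: jacobi_op_def pderiv_smult smult_add_right)

lemma jacobi_op_diff: "jacobi_op a b p q (y - w) = jacobi_op a b p q y - jacobi_op a b p q w"
  by (simp add: jacobi_op_def pderiv_diff algebra_simps smult_diff_right)

lemma jacobi_op_add: "jacobi_op a b p q (y + w) = jacobi_op a b p q y + jacobi_op a b p q w"
  by (simp add: jacobi_op_def pderiv_add algebra_simps smult_add_right)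

lemma jacobi_op_sum: "jacobi_op a b p q (sum f I) = (\<Sum>i\<in>I. jacobi_op a b p q (f i))"
  by (induction I rule: infinite_finite_induct)
     (simp_all add: jacobi_op_add, simp_all add: jacobi_op_def)

text \<open>
  The operator does not raise the degree and acts on \<open>x\<^sup>d\<close>, up to lower order terms, as the
  scalar \<open>- d (d + q - 1)\<close>.
\<close>

lemma coeff_jacobi_op_top:
  assumes "degree y \<le> d"
  shows "coeff (jacobi_op a b p q y) d = - (real d * (real d + q - 1)) * coeff y d"
proof -
  have z: "coeff y (Suc d) = 0" "coeff y (Suc (Suc d)) = 0"
    using assms by (auto intro: coeff_eq_0)
  show ?thesis
  proof (cases d)
    case 0
    with z show ?thesis by (simp add: jacobi_op_def coeff_pCons coeff_pderiv)
  next
    case (Suc e)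
    with z show ?thesis
      by (cases e) (simp_all add: jacobi_op_def coeff_pCons coeff_pderiv algebra_simps)
  qed
qed

text \<open>
  The scalars \<open>d (d + q - 1)\<close> for \<open>d < n\<close> differ from the one for \<open>d = n\<close>, so an
  eigenfunction of degree below \<open>n\<close> with the eigenvalue belonging to \<open>n\<close> is zero. The combination
  that cancels the coefficients of \<open>x\<^sup>n\<close> is such an eigenfunction. Comparing leading coefficients
  rather than values at a point avoids the summation formula of Chu and Vandermonde.
\<close>

lemma jacobi_op_eigen_unique:
  fixes n :: nat
  assumes y: "jacobi_op a b p q y = smult (- \<mu>) y" "degree y \<le> n"
    and w: "jacobi_op a b p q w = smult (- \<mu>) w" "degree w \<le> n"
    and mu: "\<mu> = real n * (real n + q - 1)"
    and nz: "n > 0 \<Longrightarrow> real n + q - 1 > 0"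
  shows "smult (coeff w n) y = smult (coeff y n) w"
proof -
  define u where "u = smult (coeff w n) y - smult (coeff y n) w"
  have u: "jacobi_op a b p q u = smult (- \<mu>) u"
    by (simp add: u_def jacobi_op_diff jacobi_op_smult y w algebra_simps smult_diff_right)
  have deg: "degree u \<le> n"
    unfolding u_def using y w by (intro degree_diff_le) (auto intro: order_trans[OF degree_smult_le])
  have "coeff u n = 0" by (simp add: u_def)
  have "u = 0"
  proof (rule ccontr)
    assume "u \<noteq> 0"
    define d where "d = degree u"
    have "coeff u d \<noteq> 0" using \<open>u \<noteq> 0\<close> d_def by simp
    with \<open>coeff u n = 0\<close> deg have "d < n" by (metis d_def le_neq_implies_less)
    have "- (real d * (real d + q - 1)) * coeff u d = - \<mu> * coeff u d"
      using coeff_jacobi_op_top[of u d a b p q] unfolding u by (simp only: d_def coeff_smult order_refl)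
    hence "real d * (real d + q - 1) = real n * (real n + q - 1)"
      using \<open>coeff u d \<noteq> 0\<close> mu by simp
    hence "(real n - real d) * (real n + real d + q - 1) = 0" by (simp add: algebra_simps)
    with nz \<open>d < n\<close> show False by auto
  qed
  thus ?thesis by (simp add: u_def)
qed

section \<open>Hypergeometric polynomials\<close>

text \<open>
  This is \<open>(c)\<^sub>n\<close> times the hypergeometric polynomial \<open>\<^sub>2F\<^sub>1(-n, N; c; s)\<close>, with the
  denominators \<open>(c)\<^sub>k\<close> cleared: the parameter \<open>c\<close> may be zero or negative, as it
  is for \<open>c = \<lambda> + 1\<close> when \<open>\<lambda> \<le> -1\<close>.
\<close>

definition hyp_poly :: "nat \<Rightarrow> real \<Rightarrow> real \<Rightarrow> real poly" where
  "hyp_poly n N c = (\<Sum>k\<le>n. monom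
     (of_nat (n choose k) * pochhammer N k * pochhammer (c + of_nat k) (n - k) * (-1) ^ k) k)"

lemma coeff_hyp_poly:
  "coeff (hyp_poly n N c) k =
     of_nat (n choose k) * pochhammer N k * pochhammer (c + of_nat k) (n - k) * (-1) ^ k"
  by (auto simp: hyp_poly_def coeff_sum sum.delta' binomial_eq_0 not_le)

lemma poly_hyp_poly:
  "poly (hyp_poly n N c) s = (\<Sum>k\<le>n. of_nat (n choose k) * pochhammer N k
     * pochhammer (c + of_nat k) (n - k) * (- s) ^ k)"
  by (simp add: hyp_poly_def poly_sum poly_monom power_minus[of s] mult_ac)

lemma degree_hyp_poly: "degree (hyp_poly n N c) \<le> n"
  by (rule degree_le) (simp add: coeff_hyp_poly)

text \<open>
  The two-term recurrence that is equivalent to the hypergeometric differential equation.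
\<close>

lemma coeff_hyp_poly_Suc:
  "(real k + 1) * (real k + c) * coeff (hyp_poly n N c) (Suc k)
     = (real k - real n) * (real k + N) * coeff (hyp_poly n N c) k"
proof (cases "k < n")
  case True
  then obtain m where m: "n - k = Suc m" "n - Suc k = m" by (metis Suc_diff_Suc)
  have poch: "pochhammer (c + real k) (n - k) = (c + real k) * pochhammer (c + real (Suc k)) m"
    by (simp add: m pochhammer_rec add_ac)
  have "Suc k * (n choose Suc k) = (n - k) * (n choose k)"
    using binomial_absorb_comp[of n k] binomial_absorption[of k n] by simp
  hence "real (Suc k) * real (n choose Suc k) = real (n - k) * real (n choose k)"
    by (metis of_nat_mult)
  hence bin: "(real k + 1) * real (n choose Suc k) = (real n - real k) * real (n choose k)"
    using True by (simp add: of_nat_diff add.commute)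
  have "(real k + 1) * (real k + c) * coeff (hyp_poly n N c) (Suc k)
      = - (((real k + 1) * real (n choose Suc k)) * ((c + real k) * pochhammer (c + real (Suc k)) m)
          * (real k + N) * pochhammer N k * (-1) ^ k)"
    unfolding coeff_hyp_poly m pochhammer_Suc by (simp add: mult_ac add_ac)
  also have "\<dots> = (real k - real n) * (real k + N) * coeff (hyp_poly n N c) k"
    unfolding coeff_hyp_poly bin poch[symmetric] by (simp add: algebra_simps)
  finally show ?thesis .
next
  case False
  hence "k = n \<or> k > n" by auto
  thus ?thesis by (auto simp: coeff_hyp_poly binomial_eq_0)
qed

lemma jacobi_op_hyp_poly:
  "jacobi_op 0 1 c (N - real n + 1) (hyp_poly n N c) = smult (- (real n * N)) (hyp_poly n N c)"
proof (rule poly_eqI)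
  fix k
  show "coeff (jacobi_op 0 1 c (N - real n + 1) (hyp_poly n N c)) k
          = coeff (smult (- (real n * N)) (hyp_poly n N c)) k"
  proof (cases k)
    case 0
    show ?thesis using coeff_hyp_poly_Suc[of 0 c n N]
      by (simp add: 0 jacobi_op_def coeff_pderiv)
  next
    case (Suc j)
    show ?thesis using coeff_hyp_poly_Suc[of k c n N]
      by (cases j) (simp_all add: Suc jacobi_op_def coeff_pderiv coeff_pCons algebra_simps)
  qed
qed

lemma pderiv_hyp_poly:
  "pderiv (hyp_poly (Suc n) N c) = smult (- (real (Suc n) * N)) (hyp_poly n (N + 1) (c + 1))"
proof (rule poly_eqI)
  fix k
  have "real (Suc k) * real (Suc n choose Suc k) = real (Suc n) * real (n choose k)"
    by (metis binomial_absorption diff_Suc_1 of_nat_mult)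
  hence bin: "real (Suc n choose Suc k) * real (Suc k) = real (Suc n) * real (n choose k)"
    by (simp only: mult.commute)
  have "coeff (pderiv (hyp_poly (Suc n) N c)) k
      = - ((real (Suc n choose Suc k) * real (Suc k)) * N * pochhammer (N + 1) k
          * pochhammer (c + 1 + real k) (n - k) * (-1) ^ k)"
    by (simp add: coeff_pderiv coeff_hyp_poly pochhammer_rec[of N] add_ac mult_ac
             del: of_nat_Suc binomial_Suc_Suc) (simp add: add_ac)
  also have "\<dots> = coeff (smult (- (real (Suc n) * N)) (hyp_poly n (N + 1) (c + 1))) k"
    unfolding bin by (simp add: coeff_hyp_poly mult_ac)
  finally show "coeff (pderiv (hyp_poly (Suc n) N c)) k
      = coeff (smult (- (real (Suc n) * N)) (hyp_poly n (N + 1) (c + 1))) k" .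
qed

text \<open>
  The bound \<open>n\<close> need not be the exact degree of \<open>p\<close>, which spares arguments that leading
  coefficients do not vanish.
\<close>

lemma coeff_pcompose_top:
  fixes p q :: "'a :: idom poly"
  assumes "degree p \<le> n" "degree q > 0"
  shows "coeff (pcompose p q) (n * degree q) = coeff p n * lead_coeff q ^ n"
proof (cases "degree p = n")
  case True
  thus ?thesis using lead_coeff_comp[of q p] assms(2) by (simp add: degree_pcompose)
next
  case False
  with assms have "degree p < n" by simp
  hence "degree (pcompose p q) < n * degree q" using assms(2) by (simp add: degree_pcompose)
  thus ?thesis using \<open>degree p < n\<close> by (simp add: coeff_eq_0)
qed

lemma pderiv_pcompose_linear:
  fixes f :: "'a :: idom poly"
  shows "pderiv (pcompose f [:a, b:]) = smult b (pcompose (pderiv f) [:a, b:])"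
  by (simp add: pderiv_pcompose pderiv_pCons mult.commute)

text \<open>
  Jacobi polynomials satisfy \<open>P\<^sub>n\<^sup>\<alpha>\<^sup>,\<^sup>\<beta>(-x) = (-1)\<^sup>n P\<^sub>n\<^sup>\<beta>\<^sup>,\<^sup>\<alpha>(x)\<close>: the reflection \<open>s \<mapsto> 1 - s\<close>
  exchanges the equations for the parameters \<open>A\<close> and \<open>B\<close>, so both sides solve the same equation.
\<close>

lemma hyp_poly_reflect:
  assumes "A + B = N - real n + 1" "n > 0 \<Longrightarrow> N > 0"
  shows "pcompose (hyp_poly n N B) [:1, -1:] = smult ((-1) ^ n) (hyp_poly n N A)"
proof -
  let ?y = "pcompose (hyp_poly n N B) [:1, -1:]" and ?w = "hyp_poly n N A"
  have "pcompose (jacobi_op 0 1 B (N - real n + 1) (hyp_poly n N B)) [:1,-1:]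
          = jacobi_op 0 1 A (N - real n + 1) ?y"
    unfolding jacobi_op_def assms(1)[symmetric]
    by (rule iffD1[OF poly_eq_poly_eq_iff], rule ext)
       (simp add: poly_pcompose pderiv_pcompose_linear pderiv_minus algebra_simps)
  hence y: "jacobi_op 0 1 A (N - real n + 1) ?y = smult (- (real n * N)) ?y"
    by (simp add: jacobi_op_hyp_poly pcompose_smult pcompose_uminus)
  have degy: "degree ?y \<le> n" using degree_hyp_poly[of n N B] by (simp add: degree_pcompose)
  have cy: "coeff ?y n = (-1) ^ n * coeff (hyp_poly n N B) n"
    using coeff_pcompose_top[OF degree_hyp_poly[of n N B], of "[:1,-1:]"] by simp
  have "smult (coeff ?w n) ?y = smult (coeff ?y n) ?w"
    by (rule jacobi_op_eigen_unique[OF y degy jacobi_op_hyp_poly degree_hyp_poly])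
       (use assms in auto)
  moreover have "coeff ?w n \<noteq> 0"
    using assms(2) by (cases "n = 0") (auto simp: coeff_hyp_poly pochhammer_eq_0_iff)
  moreover have "coeff ?y n = (-1)^n * coeff ?w n" by (simp add: cy coeff_hyp_poly)
  ultimately have "smult (coeff ?w n) ?y = smult (coeff ?w n) (smult ((-1)^n) ?w)"
    by (simp add: mult_ac)
  thus ?thesis using \<open>coeff ?w n \<noteq> 0\<close> by (simp add: smult_cancel)
qed

text \<open>
  The quadratic transformation \<open>P\<^sub>2\<^sub>n\<^sup>\<lambda>\<^sup>,\<^sup>\<lambda>(z) = const * P\<^sub>n\<^sup>-\<^sup>1\<^sup>/\<^sup>2\<^sup>,\<^sup>\<lambda>(1 - 2 z\<^sup>2)\<close>: both substitutions, \<open>s = (1 - z)/2\<close>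
  and \<open>s = z\<^sup>2\<close>, carry the respective hypergeometric equation to the ultraspherical
  equation in \<open>z\<close>, and the leading coefficients give the constant.
\<close>

lemma hyp_poly_quadratic:
  assumes "l > -3/2"
  shows "pcompose (hyp_poly (2 * n) (2 * real n + 2 * l + 1) (l + 1)) [:1/2, -1/2:]
       = smult ((-1) ^ n * pochhammer (real n + l + 1) n)
           (pcompose (hyp_poly n (real n + l + 1/2) (1/2)) [:0, 0, 1:])"
proof -
  let ?h = "hyp_poly (2 * n) (2 * real n + 2 * l + 1) (l + 1)" and ?N = "real n + l + 1/2"
  let ?k = "hyp_poly n ?N (1/2)"
  let ?y = "pcompose ?h [:1/2, -1/2:]" and ?w = "pcompose ?k [:0, 0, 1:]"
  let ?\<mu> = "2 * real n * (2 * real n + 2 * l + 1)"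
  have pd2: "pderiv (pcompose f [:0, 0, 1:]) = [:0, 2:] * pcompose (pderiv f) [:0, 0, 1:]"
    for f :: "real poly"
    by (simp add: pderiv_pcompose pderiv_pCons)
  have "pcompose (jacobi_op 0 1 (l + 1) (2 * l + 2) ?h) [:1/2, -1/2:]
          = jacobi_op 1 0 0 (2 * l + 2) ?y"
    unfolding jacobi_op_def
    by (rule iffD1[OF poly_eq_poly_eq_iff], rule ext)
       (simp add: poly_pcompose pderiv_pcompose_linear pderiv_smult pderiv_minus field_simps)
  moreover have "jacobi_op 0 1 (l + 1) (2 * l + 2) ?h = smult (- ?\<mu>) ?h"
    using jacobi_op_hyp_poly[of "l + 1" "2 * real n + 2 * l + 1" "2 * n"] by (simp add: add.commute)
  ultimately have y: "jacobi_op 1 0 0 (2 * l + 2) ?y = smult (- ?\<mu>) ?y"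
    by (metis pcompose_smult)
  have "smult 4 (pcompose (jacobi_op 0 1 (1/2) (l + 3/2) ?k) [:0, 0, 1:])
          = jacobi_op 1 0 0 (2 * l + 2) ?w"
    unfolding jacobi_op_def
    by (rule iffD1[OF poly_eq_poly_eq_iff], rule ext)
       (simp add: poly_pcompose pd2 pderiv_mult pderiv_pCons pderiv_smult field_simps)
  moreover have "jacobi_op 0 1 (1/2) (l + 3/2) ?k = smult (- (real n * ?N)) ?k"
    using jacobi_op_hyp_poly[of "1/2" ?N n] by (simp add: add_ac)
  ultimately have "jacobi_op 1 0 0 (2 * l + 2) ?w = smult (4 * - (real n * ?N)) ?w"
    by (metis pcompose_smult smult_smult)
  moreover have "4 * - (real n * ?N) = - ?\<mu>" by (simp add: field_simps)
  ultimately have w: "jacobi_op 1 0 0 (2 * l + 2) ?w = smult (- ?\<mu>) ?w" by metis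
  have degy: "degree ?y \<le> 2 * n" using degree_hyp_poly by (simp add: degree_pcompose)
  have degw: "degree ?w \<le> 2 * n" using degree_hyp_poly[of n ?N "1/2"] by (simp add: degree_pcompose)
  have cy: "coeff ?y (2 * n) = pochhammer ?N n * pochhammer (?N + 1/2) n"
  proof -
    have "coeff ?y (2 * n) = coeff ?h (2 * n) * (-1/2) ^ (2 * n)"
      using coeff_pcompose_top[OF degree_hyp_poly[of "2 * n"], of "[:1/2,-1/2:]"] by simp
    also have "\<dots> = pochhammer (2 * ?N) (2 * n) / 4 ^ n"
      by (simp add: coeff_hyp_poly power_mult power_divide add_ac)
    also have "\<dots> = pochhammer ?N n * pochhammer (?N + 1/2) n"
      by (subst pochhammer_double) (simp add: power_mult)
    finally show ?thesis .
  qed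
  have cw: "coeff ?w (2 * n) = (-1) ^ n * pochhammer ?N n"
    using coeff_pcompose_top[OF degree_hyp_poly[of n ?N "1/2"], of "[:0,0,1:]"]
    by (simp add: coeff_hyp_poly mult_ac mult_2 mult_2_right)
  have nz: "pochhammer ?N n \<noteq> 0"
    using assms by (cases "n = 0") (auto simp: pochhammer_eq_0_iff)
  have "smult (coeff ?w (2 * n)) ?y = smult (coeff ?y (2 * n)) ?w"
    by (rule jacobi_op_eigen_unique[OF y degy w degw]) (use assms in auto)
  also have "coeff ?y (2 * n) = coeff ?w (2 * n) * ((-1) ^ n * pochhammer (?N + 1/2) n)"
    unfolding cy cw by (simp add: mult_ac flip: power_mult_distrib)
  also have "smult (coeff ?w (2 * n) * ((-1) ^ n * pochhammer (?N + 1/2) n)) ?w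
      = smult (coeff ?w (2 * n)) (smult ((-1) ^ n * pochhammer (?N + 1/2) n) ?w)"
    by simp
  finally have "?y = smult ((-1) ^ n * pochhammer (?N + 1/2) n) ?w"
    using nz cw by (metis mult_eq_0_iff power_eq_0_iff smult_cancel zero_neq_neg_one)
  thus ?thesis by (simp add: add_ac)
qed

section \<open>Bateman's product formula\<close>

text \<open>
  Up to the scaling \<open>A\<close>, these are the terms of the series of the Bessel-type function
  \<open>\<^sub>0F\<^sub>1(; A; q)\<close>.
\<close>

definition scaled_power :: "real \<Rightarrow> nat \<Rightarrow> real poly \<Rightarrow> real poly" where
  "scaled_power A i q = smult (1 / (fact i * pochhammer A i)) (q ^ i)"

lemma smult_sum_right: "smult c (sum f I) = (\<Sum>i\<in>I. smult c (f i))"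
  by (induction I rule: infinite_finite_induct) (simp_all add: smult_add_right)

lemma scaled_power_Suc:
  assumes "A > 0"
  shows "smult (real (Suc i) * (A + real i)) (scaled_power A (Suc i) q) = q * scaled_power A i q"
proof -
  have "A + real i \<noteq> 0" "pochhammer A i \<noteq> 0" using assms by (auto simp: pochhammer_eq_0_iff)
  thus ?thesis by (simp add: scaled_power_def pochhammer_Suc divide_simps del: of_nat_Suc)
qed

text \<open>
  The polynomials \<open>u1\<close> and \<open>u2\<close> are the first and second derivative of the scaled power with
  respect to \<open>q\<close>; the last property is the Bessel-type equation \<open>q U\<^sub>i'' + A U\<^sub>i' = U\<^sub>i\<^sub>-\<^sub>1\<close>.
\<close>

lemma scaled_power_derivs:
  assumes "A > 0"
  obtains u1 u2 where
    "\<And>q. pderiv (scaled_power A i q) = u1 q * pderiv q"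
    "\<And>q. pderiv (u1 q) = u2 q * pderiv q"
    "\<And>q. q * u1 q = smult (real i) (scaled_power A i q)"
    "\<And>q. q * u2 q + smult A (u1 q) = (if i = 0 then 0 else scaled_power A (i - 1) q)"
proof
  let ?c = "1 / (fact i * pochhammer A i)"
  let ?u1 = "\<lambda>q. smult (?c * real i) (q ^ (i - 1))"
  let ?u2 = "\<lambda>q. smult (?c * real i * real (i - 1)) (q ^ (i - 2))"
  fix q
  show "pderiv (scaled_power A i q) = ?u1 q * pderiv q"
    by (cases i) (simp_all add: scaled_power_def pderiv_smult pderiv_power_Suc mult_ac
          del: of_nat_Suc power_Suc)
  show "pderiv (?u1 q) = ?u2 q * pderiv q"
    by (cases i; cases "i - 1")
      (simp_all add: pderiv_smult pderiv_power_Suc numeral_2_eq_2 mult_ac del: of_nat_Suc power_Suc)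
  show "q * ?u1 q = smult (real i) (scaled_power A i q)"
    by (cases i) (simp_all add: scaled_power_def del: of_nat_Suc)
  show "q * ?u2 q + smult A (?u1 q) = (if i = 0 then 0 else scaled_power A (i - 1) q)"
  proof (cases i)
    case (Suc k)
    have "A + real k \<noteq> 0" "pochhammer A k \<noteq> 0" using assms by (auto simp: pochhammer_eq_0_iff)
    hence c: "?c * real i * (real k + A) = 1 / (fact k * pochhammer A k)"
      by (simp add: Suc pochhammer_Suc divide_simps del: of_nat_Suc)
    have "q * ?u2 q = smult (?c * real i * real k) (q ^ k)"
      by (cases k) (simp_all add: Suc del: of_nat_Suc)
    hence "q * ?u2 q + smult A (?u1 q) = smult (?c * real i * (real k + A)) (q ^ k)"
      by (simp add: Suc smult_add_left[symmetric] algebra_simps add_divide_distrib del: of_nat_Suc)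
    also have "\<dots> = scaled_power A k q" unfolding c scaled_power_def ..
    finally show ?thesis by (simp add: Suc)
  qed auto
qed

text \<open>
  With \<open>X = s t\<close> and \<open>Y = (1 - s) (1 - t)\<close>, the product \<open>s (1 - s) * t (1 - t)\<close> that the mixed
  second derivative produces is \<open>X Y\<close>, so the mixed term is the scalar \<open>-2 i k\<close>; the pure second
  derivatives combine with the first order terms through the Bessel-type equations of the factors.
\<close>

lemma jacobi_op_scaled_power_mult:
  fixes t :: real
  assumes "A > 0" "B > 0"
  defines "U \<equiv> \<lambda>i. scaled_power A i [:0, t:]" and "V \<equiv> \<lambda>k. scaled_power B k [:1 - t, - (1 - t):]"
  shows "jacobi_op 0 1 A (A + B) (U i * V k) =
    [:t, -t:] * ((if i = 0 then 0 else U (i - 1)) * V k)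
    + [:0, 1 - t:] * (U i * (if k = 0 then 0 else V (k - 1)))
    - smult (2 * real i * real k + B * real i + A * real k) (U i * V k)"
proof -
  define X Y where XY: "X = [:0, t:]" "Y = [:1 - t, - (1 - t):]"
  have UV: "U = (\<lambda>i. scaled_power A i X)" "V = (\<lambda>k. scaled_power B k Y)"
    by (simp_all add: U_def V_def XY)
  obtain u1 u2 where u:
    "\<And>q. pderiv (scaled_power A i q) = u1 q * pderiv q"
    "\<And>q. pderiv (u1 q) = u2 q * pderiv q"
    "\<And>q. q * u1 q = smult (real i) (scaled_power A i q)"
    "\<And>q. q * u2 q + smult A (u1 q) = (if i = 0 then 0 else scaled_power A (i - 1) q)"
    using scaled_power_derivs[OF assms(1), of i] by metis
  obtain v1 v2 where v:
    "\<And>q. pderiv (scaled_power B k q) = v1 q * pderiv q"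
    "\<And>q. pderiv (v1 q) = v2 q * pderiv q"
    "\<And>q. q * v1 q = smult (real k) (scaled_power B k q)"
    "\<And>q. q * v2 q + smult B (v1 q) = (if k = 0 then 0 else scaled_power B (k - 1) q)"
    using scaled_power_derivs[OF assms(2), of k] by metis
  have dX: "pderiv X = [:t:]" and dY: "pderiv Y = [:- (1 - t):]"
    by (simp_all add: XY pderiv_pCons)
  show ?thesis
  proof (rule iffD1[OF poly_eq_poly_eq_iff], rule ext)
    fix s
    have h: "s * t * poly (u1 X) s = real i * poly (U i) s"
      "(1 - s) * (1 - t) * poly (v1 Y) s = real k * poly (V k) s"
      using arg_cong[OF u(3)[of X], of "\<lambda>p. poly p s"] arg_cong[OF v(3)[of Y], of "\<lambda>p. poly p s"]
      by (simp_all add: UV XY algebra_simps)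
    have g: "poly (if i = 0 then 0 else U (i - 1)) s = s * t * poly (u2 X) s + A * poly (u1 X) s"
      "poly (if k = 0 then 0 else V (k - 1)) s
         = (1 - s) * (1 - t) * poly (v2 Y) s + B * poly (v1 Y) s"
      unfolding UV u(4)[symmetric] v(4)[symmetric] by (simp_all add: XY algebra_simps)
    have d1: "pderiv (U i * V k) = smult t (u1 X * V k) - smult (1 - t) (U i * v1 Y)"
      by (simp add: pderiv_mult UV u v dX dY mult_ac del: minus_diff_eq)
    have d2: "pderiv (pderiv (U i * V k)) = smult (t\<^sup>2) (u2 X * V k)
       - smult (2 * t * (1 - t)) (u1 X * v1 Y) + smult ((1 - t)\<^sup>2) (U i * v2 Y)"
      unfolding d1
      by (rule iffD1[OF poly_eq_poly_eq_iff], rule ext)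
         (simp add: pderiv_mult pderiv_diff pderiv_smult u v dX dY UV algebra_simps power2_eq_square)
    have "(2 * real i * real k + B * real i + A * real k) * (poly (U i) s * poly (V k) s)
        = 2 * (real i * poly (U i) s) * (real k * poly (V k) s)
          + B * (real i * poly (U i) s) * poly (V k) s
          + A * poly (U i) s * (real k * poly (V k) s)"
      by (simp add: algebra_simps)
    note e = this[folded h]
    show "poly (jacobi_op 0 1 A (A + B) (U i * V k)) s = poly (
      [:t, -t:] * ((if i = 0 then 0 else U (i - 1)) * V k)
      + [:0, 1 - t:] * (U i * (if k = 0 then 0 else V (k - 1)))
      - smult (2 * real i * real k + B * real i + A * real k) (U i * V k)) s"
      unfolding jacobi_op_def d2 unfolding d1 poly_add poly_diff poly_mult poly_smult g e
      by (simp add: algebra_simps power2_eq_square)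
  qed
qed

text \<open>
  For fixed \<open>t\<close>, a polynomial in \<open>s\<close>. In the original variables \<open>x = 1 - 2 s\<close>, \<open>y = 1 - 2 t\<close> it is
  a multiple of \<open>(x + y)\<^sup>j P\<^sub>j((1 + x y) / (x + y))\<close>, where \<open>P\<^sub>j\<close> is the Jacobi polynomial with
  parameters \<open>A - 1\<close> and \<open>B - 1\<close>.
\<close>

definition bateman_poly :: "real \<Rightarrow> real \<Rightarrow> real \<Rightarrow> nat \<Rightarrow> real poly" where
  "bateman_poly A B t j =
     (\<Sum>i\<le>j. scaled_power A i [:0, t:] * scaled_power B (j - i) [:1 - t, - (1 - t):])"

text \<open>
  Summing the previous lemma over \<open>i + k = j\<close> gives \<open>t (1 - s) + s (1 - t) = 1 - X - Y\<close> times
  the polynomial of index \<open>j - 1\<close>. The multiplications by \<open>X\<close> and \<open>Y\<close> shift the index back up, and all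
  the scalars add up to \<open>j (j + A + B - 1)\<close>.
\<close>

lemma jacobi_op_bateman_poly:
  assumes "A > 0" "B > 0"
  shows "jacobi_op 0 1 A (A + B) (bateman_poly A B t j) =
    (if j = 0 then 0 else bateman_poly A B t (j - 1))
      - smult (real j * (real j + A + B - 1)) (bateman_poly A B t j)"
proof (cases j)
  case 0
  thus ?thesis by (simp add: bateman_poly_def scaled_power_def jacobi_op_def)
next
  case (Suc m)
  define X Y where XY: "X = [:0, t:]" "Y = [:1 - t, - (1 - t):]"
  define U V where UV: "U = (\<lambda>i. scaled_power A i X)" "V = (\<lambda>k. scaled_power B k Y)"
  define c where "c = (\<lambda>i. 2 * real i * real (j - i) + B * real i + A * real (j - i))"
  let ?G = "bateman_poly A B t"
  have G: "?G j = (\<Sum>i\<le>j. U i * V (j - i))" for j by (simp add: bateman_poly_def UV XY)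
  have S1: "(\<Sum>i\<le>j. (if i = 0 then 0 else f (i - 1)) * V (j - i)) = (\<Sum>i\<le>m. f i * V (m - i))"
    for f :: "nat \<Rightarrow> real poly"
    unfolding Suc by (subst sum.atMost_Suc_shift) simp
  have S2: "(\<Sum>i\<le>j. U i * (if j - i = 0 then 0 else f (j - i - 1))) = (\<Sum>i\<le>m. U i * f (m - i))"
    for f :: "nat \<Rightarrow> real poly"
    unfolding Suc by (simp add: Suc_diff_le)
  have "jacobi_op 0 1 A (A + B) (?G j) = (\<Sum>i\<le>j.
          [:t, -t:] * ((if i = 0 then 0 else U (i - 1)) * V (j - i))
          + [:0, 1 - t:] * (U i * (if j - i = 0 then 0 else V (j - i - 1)))
          - smult (c i) (U i * V (j - i)))"
    unfolding G jacobi_op_sum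
    by (rule sum.cong[OF refl]) (simp only: UV XY c_def jacobi_op_scaled_power_mult[OF assms])
  also have "\<dots> = [:t, -t:] * ?G m + [:0, 1 - t:] * ?G m - (\<Sum>i\<le>j. smult (c i) (U i * V (j - i)))"
    by (simp only: sum_subtractf sum.distrib flip: sum_distrib_left) (simp only: S1 S2 G)
  also have "[:t, -t:] * ?G m + [:0, 1 - t:] * ?G m = ([:t, -t:] + [:0, 1 - t:]) * ?G m"
    by (simp only: distrib_right)
  also have "[:t, -t:] + [:0, 1 - t:] = 1 - X - Y"
    by (simp add: XY one_pCons)
  also have "(1 - X - Y) * ?G m - (\<Sum>i\<le>j. smult (c i) (U i * V (j - i)))
      = ?G m - (X * ?G m + Y * ?G m + (\<Sum>i\<le>j. smult (c i) (U i * V (j - i))))"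
    by (simp add: algebra_simps)
  also have "X * ?G m = (\<Sum>i\<le>j. smult (real i * (real i - 1 + A)) (U i * V (j - i)))"
  proof -
    have "X * ?G m = (\<Sum>i\<le>m. (X * U i) * V (m - i))" by (simp add: G sum_distrib_left mult_ac)
    also have "\<dots> = (\<Sum>i\<le>j. (if i = 0 then 0 else X * U (i - 1)) * V (j - i))"
      by (simp only: S1[of "\<lambda>i. X * U i"])
    also have "\<dots> = (\<Sum>i\<le>j. smult (real i * (real i - 1 + A)) (U i * V (j - i)))"
    proof (rule sum.cong[OF refl])
      fix i
      show "(if i = 0 then 0 else X * U (i - 1)) * V (j - i)
          = smult (real i * (real i - 1 + A)) (U i * V (j - i))"
        using scaled_power_Suc[OF assms(1), of "i - 1" X, symmetric]
        by (cases i) (simp_all add: UV add_ac)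
    qed
    finally show ?thesis .
  qed
  also have "Y * ?G m = (\<Sum>i\<le>j. smult (real (j - i) * (real (j - i) - 1 + B)) (U i * V (j - i)))"
  proof -
    have "Y * ?G m = (\<Sum>i\<le>m. U i * (Y * V (m - i)))" by (simp add: G sum_distrib_left mult_ac)
    also have "\<dots> = (\<Sum>i\<le>j. U i * (if j - i = 0 then 0 else Y * V (j - i - 1)))"
      by (simp only: S2[of "\<lambda>k. Y * V k"])
    also have "\<dots> = (\<Sum>i\<le>j. smult (real (j - i) * (real (j - i) - 1 + B)) (U i * V (j - i)))"
    proof (rule sum.cong[OF refl])
      fix i
      show "U i * (if j - i = 0 then 0 else Y * V (j - i - 1))
          = smult (real (j - i) * (real (j - i) - 1 + B)) (U i * V (j - i))"
        using scaled_power_Suc[OF assms(2), of "j - i - 1" Y, symmetric]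
        by (cases "j - i") (simp_all add: UV add_ac)
    qed
    finally show ?thesis .
  qed
  also have "(\<Sum>i\<le>j. smult (real i * (real i - 1 + A)) (U i * V (j - i)))
      + (\<Sum>i\<le>j. smult (real (j - i) * (real (j - i) - 1 + B)) (U i * V (j - i)))
      + (\<Sum>i\<le>j. smult (c i) (U i * V (j - i))) = smult (real j * (real j + A + B - 1)) (?G j)"
  proof -
    have "real i * (real i - 1 + A) + real (j - i) * (real (j - i) - 1 + B) + c i
        = real j * (real j + A + B - 1)" if "i \<le> j" for i
      using that by (simp add: c_def of_nat_diff algebra_simps)
    thus ?thesis
      by (simp add: G smult_sum_right flip: sum.distrib smult_add_left)
  qed
  finally show ?thesis by (simp add: Suc)
qed

text \<open>
  The coefficients \<open>(-1)\<^sup>j j! (n choose j) (N)\<^sub>j = (-n)\<^sub>j (N)\<^sub>j\<close> solve the recurrence that turns the triangular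
  action of the Jacobi operator into an eigenvalue equation. By uniqueness the sum is a multiple of
  the hypergeometric polynomial in \<open>s\<close>; at \<open>s = 0\<close> only the summands with \<open>i = 0\<close>
  survive and form the reflected hypergeometric polynomial in \<open>t\<close>.
\<close>

lemma bateman_product_formula:
  fixes n :: nat and A B s t :: real
  assumes "A > 0" "B > 0"
  defines "N \<equiv> real n + A + B - 1"
  shows "pochhammer A n * pochhammer B n *
      (\<Sum>j\<le>n. (-1) ^ j * fact j * real (n choose j) * pochhammer N j *
         (\<Sum>i\<le>j. (s * t) ^ i / (fact i * pochhammer A i) *
            ((1 - s) * (1 - t)) ^ (j - i) / (fact (j - i) * pochhammer B (j - i))))
    = (-1) ^ n * poly (hyp_poly n N A) s * poly (hyp_poly n N A) t"
proof -
  define a where "a = (\<lambda>j. (-1) ^ j * fact j * real (n choose j) * pochhammer N j :: real)"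
  let ?G = "bateman_poly A B t" and ?J = "hyp_poly n N A"
  define F where "F = (\<Sum>j\<le>n. smult (a j) (?G j))"
  have aSuc: "a (Suc j) = (real j * (real j + A + B - 1) - real n * N) * a j" if "j \<le> n" for j
  proof -
    have "Suc j * (n choose Suc j) = (n - j) * (n choose j)"
      using binomial_absorb_comp[of n j] binomial_absorption[of j n] by simp
    hence "real (Suc j) * real (n choose Suc j) = real (n - j) * real (n choose j)"
      by (metis of_nat_mult)
    hence bin: "real (Suc j) * real (n choose Suc j) = (real n - real j) * real (n choose j)"
      using that by (simp add: of_nat_diff)
    have "a (Suc j) = - ((-1) ^ j * fact j * pochhammer N j * (N + real j)
                         * (real (Suc j) * real (n choose Suc j)))"
      by (simp add: a_def pochhammer_Suc del: of_nat_Suc)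
    also have "\<dots> = (real j * (real j + A + B - 1) - real n * N) * a j"
      unfolding bin by (simp add: a_def N_def algebra_simps)
    finally show ?thesis .
  qed
  have "jacobi_op 0 1 A (A + B) F = (\<Sum>j\<le>n. smult (a j) (if j = 0 then 0 else ?G (j - 1)))
          - (\<Sum>j\<le>n. smult (a j * (real j * (real j + A + B - 1))) (?G j))"
    by (simp add: F_def jacobi_op_sum jacobi_op_smult jacobi_op_bateman_poly[OF assms(1,2)]
        smult_diff_right sum_subtractf)
  \<comment> \<open>The coefficient of index \<open>n + 1\<close> is zero, which lets the index be shifted.\<close>
  also have "(\<Sum>j\<le>n. smult (a j) (if j = 0 then 0 else ?G (j - 1)))
      = (\<Sum>j\<le>Suc n. smult (a j) (if j = 0 then 0 else ?G (j - 1)))"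
    by (simp add: a_def)
  also have "\<dots> = (\<Sum>j\<le>n. smult (a (Suc j)) (?G j))"
    by (subst sum.atMost_Suc_shift) simp
  also have "\<dots> - (\<Sum>j\<le>n. smult (a j * (real j * (real j + A + B - 1))) (?G j))
      = smult (- (real n * N)) F"
    unfolding sum_subtractf[symmetric] smult_diff_left[symmetric] F_def smult_sum_right
    by (rule sum.cong[OF refl]) (simp add: aSuc algebra_simps flip: smult_diff_left)
  finally have F: "jacobi_op 0 1 A (A + B) F = smult (- (real n * N)) F" .
  have degG: "degree (?G j) \<le> j" for j
    unfolding bateman_poly_def
  proof (rule degree_sum_le)
    fix i assume "i \<in> {..j}"
    have "degree (scaled_power A i [:0, t:]) \<le> i"
      using degree_power_le[of "[:0, t:]" i]
      by (auto simp: scaled_power_def intro!: order_trans[OF degree_smult_le] split: if_splits)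
    moreover have "degree (scaled_power B (j - i) [:1 - t, - (1 - t):]) \<le> j - i"
      using degree_power_le[of "[:1 - t, - (1 - t):]" "j - i"]
      by (auto simp: scaled_power_def intro!: order_trans[OF degree_smult_le] split: if_splits)
    ultimately show "degree (scaled_power A i [:0, t:] * scaled_power B (j - i) [:1 - t, - (1 - t):]) \<le> j"
      using \<open>i \<in> {..j}\<close> by (intro order_trans[OF degree_mult_le]) auto
  qed simp
  have degF: "degree F \<le> n" unfolding F_def
    by (rule degree_sum_le) (auto intro: order_trans[OF degree_smult_le] order_trans[OF degG])
  have J: "jacobi_op 0 1 A (A + B) ?J = smult (- (real n * N)) ?J"
    using jacobi_op_hyp_poly[of A N n] by (simp add: N_def)
  have propor: "smult (coeff ?J n) F = smult (coeff F n) ?J"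
    by (rule jacobi_op_eigen_unique[OF F degF J degree_hyp_poly])
       (use assms(1,2) in \<open>auto simp: N_def algebra_simps\<close>)
  have J0: "poly ?J 0 = pochhammer A n"
    by (simp add: poly_hyp_poly sum.atMost_shift)
  have lc: "coeff ?J n \<noteq> 0"
    using assms(1,2) by (cases "n = 0") (auto simp: coeff_hyp_poly pochhammer_eq_0_iff N_def)
  have F0: "pochhammer B n * poly F 0 = poly (hyp_poly n N B) (1 - t)"
  proof -
    have G0: "poly (?G j) 0 = (1 - t) ^ j / (fact j * pochhammer B j)" for j
      by (simp add: bateman_poly_def scaled_power_def poly_sum sum.atMost_shift poly_power)
    have "pochhammer B n * (a j * poly (?G j) 0) = real (n choose j) * pochhammer N j
        * pochhammer (B + real j) (n - j) * (- (1 - t)) ^ j" if "j \<le> n" for j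
    proof -
      have "pochhammer B n = pochhammer B j * pochhammer (B + real j) (n - j)"
        using pochhammer_product[OF that, of B] .
      moreover have "pochhammer B j \<noteq> 0" using assms(2) by (auto simp: pochhammer_eq_0_iff)
      ultimately show ?thesis by (simp add: G0 a_def power_minus[of "1 - t"] del: minus_diff_eq)
    qed
    thus ?thesis by (simp add: F_def poly_sum sum_distrib_left poly_hyp_poly del: minus_diff_eq)
  qed
  have "poly (hyp_poly n N B) (1 - t) = poly (pcompose (hyp_poly n N B) [:1, -1:]) t"
    by (simp add: poly_pcompose)
  also have "\<dots> = (-1) ^ n * poly ?J t"
    by (subst hyp_poly_reflect[of A]) (use assms(1,2) in \<open>auto simp: N_def\<close>)
  finally have F0': "pochhammer B n * poly F 0 = (-1) ^ n * poly ?J t" using F0 by simp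
  have "coeff ?J n * poly F s = coeff F n * poly ?J s"
    using arg_cong[OF propor, of "\<lambda>p. poly p s"] by simp
  moreover have "coeff ?J n * poly F 0 = coeff F n * pochhammer A n"
    using arg_cong[OF propor, of "\<lambda>p. poly p 0"] J0 by simp
  ultimately have "coeff ?J n * (pochhammer A n * poly F s) = coeff ?J n * (poly F 0 * poly ?J s)"
    by algebra
  hence "pochhammer A n * poly F s = poly F 0 * poly ?J s" using lc by simp
  hence "pochhammer A n * pochhammer B n * poly F s = (-1) ^ n * poly ?J s * poly ?J t"
    using F0' by (metis (no_types, opaque_lifting) mult.assoc mult.commute)
  also have "poly F s = (\<Sum>j\<le>n. a j * (\<Sum>i\<le>j. (s * t) ^ i / (fact i * pochhammer A i) *
            ((1 - s) * (1 - t)) ^ (j - i) / (fact (j - i) * pochhammer B (j - i))))"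
    by (simp add: F_def poly_sum bateman_poly_def scaled_power_def poly_power algebra_simps)
  finally show ?thesis unfolding a_def .
qed

section \<open>Moments and integration by parts for polynomials\<close>

text \<open>
  The linear functional on polynomials with \<open>x\<^sup>k \<mapsto> \<phi> k\<close>.
\<close>

definition coeff_functional :: "(nat \<Rightarrow> real) \<Rightarrow> real poly \<Rightarrow> real" where
  "coeff_functional \<phi> P = (\<Sum>k\<le>degree P. coeff P k * \<phi> k)"

lemma coeff_functional_bound:
  assumes "degree P \<le> d"
  shows "coeff_functional \<phi> P = (\<Sum>k\<le>d. coeff P k * \<phi> k)"
  unfolding coeff_functional_def using assms
  by (intro sum.mono_neutral_left) (auto simp: coeff_eq_0)

lemma coeff_functional_smult: "coeff_functional \<phi> (smult c P) = c * coeff_functional \<phi> P"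
  by (subst coeff_functional_bound[OF degree_smult_le])
     (simp add: coeff_functional_def sum_distrib_left mult_ac)

lemma coeff_functional_pCons:
  "coeff_functional \<phi> (pCons a P) = a * \<phi> 0 + coeff_functional (\<lambda>k. \<phi> (Suc k)) P"
  by (subst coeff_functional_bound[OF degree_pCons_le])
     (simp add: coeff_functional_def sum.atMost_Suc_shift del: sum.atMost_Suc)

lemma coeff_functional_pderiv:
  "coeff_functional \<phi> (pderiv P) = coeff_functional (\<lambda>k. real k * \<phi> (k - 1)) P"
proof -
  have "coeff_functional (\<lambda>k. real k * \<phi> (k - 1)) P
      = (\<Sum>k\<le>Suc (degree P). coeff P k * (real k * \<phi> (k - 1)))"
    by (rule coeff_functional_bound) simp
  also have "\<dots> = (\<Sum>k\<le>degree P. coeff (pderiv P) k * \<phi> k)"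
    by (subst sum.atMost_Suc_shift) (simp add: coeff_pderiv mult_ac del: of_nat_Suc)
  also have "\<dots> = coeff_functional \<phi> (pderiv P)"
    by (rule coeff_functional_bound[symmetric]) (simp add: degree_pderiv)
  finally show ?thesis ..
qed

lemma coeff_functional_square:
  "coeff_functional \<phi> (pcompose P [:0, 0, 1:]) = coeff_functional (\<lambda>k. \<phi> (2 * k)) P"
proof (induction P arbitrary: \<phi> rule: pCons_induct)
  case 0
  show ?case by (simp add: coeff_functional_def)
next
  case (pCons a P)
  have "pcompose (pCons a P) [:0, 0, 1:] = pCons a (pCons 0 (pcompose P [:0, 0, 1:]))"
    by (simp add: pcompose_pCons)
  thus ?case by (simp add: coeff_functional_pCons pCons.IH)
qed

text \<open>
  The formal integral of \<open>(u S + v T)\<^sup>k\<close> when \<open>u\<^sup>i\<close> integrates to \<open>\<mu> i\<close> and \<open>v\<^sup>i\<close> to \<open>\<nu> i\<close>.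
\<close>

definition binomial_conv ::
  "real \<Rightarrow> real \<Rightarrow> (nat \<Rightarrow> real) \<Rightarrow> (nat \<Rightarrow> real) \<Rightarrow> nat \<Rightarrow> real" where
  "binomial_conv S T \<mu> \<nu> k = (\<Sum>i\<le>k. real (k choose i) * S ^ i * T ^ (k - i) * \<mu> i * \<nu> (k - i))"

text \<open>
  The moments of the two half unit masses at \<open>-1\<close> and \<open>1\<close>.
\<close>

definition even_moment :: "nat \<Rightarrow> real" where
  "even_moment k = (if even k then 1 else 0)"

text \<open>
  For \<open>\<alpha> \<ge> -1/2\<close> these are the moments of the probability measure \<open>d\<Pi>\<^sub>\<alpha>\<close>; the formula continues them
  analytically to \<open>\<alpha> > -1\<close>.
\<close>

definition Pi_moment :: "real \<Rightarrow> nat \<Rightarrow> real" where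
  "Pi_moment \<alpha> k =
     (if even k then pochhammer (1/2) (k div 2) / pochhammer (\<alpha> + 1) (k div 2) else 0)"

text \<open>
  Because \<open>(2 j)! = 4\<^sup>j j! (1/2)\<^sub>j\<close>, the factors \<open>(1/2)\<^sub>i (1/2)\<^sub>j\<^sub>-\<^sub>i\<close> turn the binomial coefficient of
  \<open>2 j\<close> over \<open>2 i\<close> into \<open>(1/2)\<^sub>j\<close> times that of \<open>j\<close> over \<open>i\<close>, which is how the sums of Bateman arise.
\<close>

lemma binomial_conv_Pi_moment:
  fixes S T \<alpha> \<beta> :: real
  shows "binomial_conv S T (Pi_moment \<alpha>) (Pi_moment \<beta>) (2 * j)
    = pochhammer (1/2) j * fact j * (\<Sum>i\<le>j. (S\<^sup>2) ^ i / (fact i * pochhammer (\<alpha> + 1) i) *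
        (T\<^sup>2) ^ (j - i) / (fact (j - i) * pochhammer (\<beta> + 1) (j - i)))"
proof -
  let ?f = "\<lambda>i. real (2 * j choose i) * S ^ i * T ^ (2 * j - i) * Pi_moment \<alpha> i * Pi_moment \<beta> (2 * j - i)"
  have "binomial_conv S T (Pi_moment \<alpha>) (Pi_moment \<beta>) (2 * j) = sum ?f ((*) 2 ` {..j})"
    unfolding binomial_conv_def
  proof (rule sum.mono_neutral_right)
    show "\<forall>i\<in>{..2 * j} - (*) 2 ` {..j}. ?f i = 0"
      by (auto simp: Pi_moment_def elim!: evenE)
  qed auto
  also have "\<dots> = (\<Sum>i\<le>j. ?f (2 * i))"
    by (subst sum.reindex) (auto simp: inj_on_def)
  also have "\<dots> = (\<Sum>i\<le>j. pochhammer (1/2) j * fact j * ((S\<^sup>2) ^ i / (fact i * pochhammer (\<alpha> + 1) i) *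
        (T\<^sup>2) ^ (j - i) / (fact (j - i) * pochhammer (\<beta> + 1) (j - i))))"
  proof (rule sum.cong[OF refl])
    fix i assume "i \<in> {..j}"
    hence i: "i \<le> j" by simp
    have d: "2 * j - 2 * i = 2 * (j - i)" by simp
    have half: "pochhammer (1/2 :: real) m \<noteq> 0" for m
      by (auto simp: pochhammer_eq_0_iff)
    have "real (2 * j choose (2 * i)) * (pochhammer (1/2) i * pochhammer (1/2) (j - i))
        = pochhammer (1/2) j * fact j / (fact i * fact (j - i))"
      using i half[of i] half[of "j - i"] 
      by (simp add: binomial_fact d fact_double divide_simps power_add[symmetric])
        (use i in arith)
    note bin = this
    have alg: "c * x * y * (p / a) * (q / b) = P * (x / (f * a) * y / (g * b))"
      if "c * (p * q) = P / (f * g)" for a b c f g p q x y P :: real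
    proof -
      have "c * x * y * (p / a) * (q / b) = c * (p * q) * (x * y / (a * b))" by simp
      also have "\<dots> = P * (x / (f * a) * y / (g * b))" unfolding that by simp
      finally show ?thesis .
    qed
    have "?f (2 * i) = real (2 * j choose (2 * i)) * (S\<^sup>2) ^ i * (T\<^sup>2) ^ (j - i)
        * (pochhammer (1/2) i / pochhammer (\<alpha> + 1) i)
        * (pochhammer (1/2) (j - i) / pochhammer (\<beta> + 1) (j - i))"
      unfolding d by (simp add: Pi_moment_def power_mult)
    also have "\<dots> = pochhammer (1/2) j * fact j * ((S\<^sup>2) ^ i / (fact i * pochhammer (\<alpha> + 1) i) *
        (T\<^sup>2) ^ (j - i) / (fact (j - i) * pochhammer (\<beta> + 1) (j - i)))"
      by (rule alg[OF bin])
    finally show "?f (2 * i) = pochhammer (1/2) j * fact j * ((S\<^sup>2) ^ i / (fact i * pochhammer (\<alpha> + 1) i) *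
        (T\<^sup>2) ^ (j - i) / (fact (j - i) * pochhammer (\<beta> + 1) (j - i)))" .
  qed
  finally show ?thesis by (simp add: sum_distrib_left)
qed

lemma binomial_conv_swap: "binomial_conv S T \<mu> \<nu> k = binomial_conv T S \<nu> \<mu> k"
proof -
  have "binomial_conv S T \<mu> \<nu> k
      = (\<Sum>i\<le>k. real (k choose (k - i)) * S ^ (k - i) * T ^ i * \<mu> (k - i) * \<nu> i)"
    unfolding binomial_conv_def
    by (rule sum.reindex_bij_witness[of _ "\<lambda>i. k - i" "\<lambda>i. k - i"]) auto
  also have "\<dots> = binomial_conv T S \<nu> \<mu> k"
    unfolding binomial_conv_def
    by (rule sum.cong) (auto simp: binomial_symmetric[symmetric])
  finally show ?thesis .
qed

text \<open>
  Integration by parts in \<open>v\<close>, on the level of moments: the derivative of \<open>(u S + v T)\<^sup>k\<close> with respect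
  to \<open>v\<close> is \<open>T k (u S + v T)\<^sup>k\<^sup>-\<^sup>1\<close>.
\<close>

lemma binomial_conv_parts:
  "T * (real k * binomial_conv S T \<mu> \<nu> (k - 1)) = binomial_conv S T \<mu> (\<lambda>j. real j * \<nu> (j - 1)) k"
proof (cases k)
  case 0
  thus ?thesis by (simp add: binomial_conv_def)
next
  case (Suc m)
  have "binomial_conv S T \<mu> (\<lambda>j. real j * \<nu> (j - 1)) k
      = (\<Sum>i\<le>m. real (Suc m choose i) * S ^ i * T ^ (Suc m - i) * \<mu> i * (real (Suc m - i) * \<nu> (m - i)))"
    by (simp add: Suc binomial_conv_def)
  also have "\<dots> = (\<Sum>i\<le>m. T * (real (Suc m) * (real (m choose i) * S ^ i * T ^ (m - i) * \<mu> i * \<nu> (m - i))))"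
  proof (rule sum.cong[OF refl])
    fix i assume "i \<in> {..m}"
    hence i: "i \<le> m" by simp
    have "real (Suc m - i) * real (Suc m choose i) = real (Suc m) * real (m choose i)"
      by (metis binomial_absorb_comp diff_Suc_1 of_nat_mult)
    hence "real (Suc m - i) * real (Suc m choose i) * (S ^ i * T ^ Suc (m - i) * \<mu> i * \<nu> (m - i))
        = real (Suc m) * real (m choose i) * (S ^ i * T ^ Suc (m - i) * \<mu> i * \<nu> (m - i))"
      by (simp only:)
    thus "real (Suc m choose i) * S ^ i * T ^ (Suc m - i) * \<mu> i * (real (Suc m - i) * \<nu> (m - i))
        = T * (real (Suc m) * (real (m choose i) * S ^ i * T ^ (m - i) * \<mu> i * \<nu> (m - i)))"
      using i by (simp add: Suc_diff_le mult_ac del: of_nat_Suc binomial_Suc_Suc)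
  qed
  finally show ?thesis by (simp add: Suc binomial_conv_def sum_distrib_left)
qed

lemma coeff_functional_pderiv_conv:
  "T * coeff_functional (binomial_conv S T \<mu> \<nu>) (pderiv P)
     = coeff_functional (binomial_conv S T \<mu> (\<lambda>j. real j * \<nu> (j - 1))) P"
  unfolding coeff_functional_pderiv unfolding coeff_functional_def sum_distrib_left
proof (rule sum.cong[OF refl])
  fix k
  show "T * (coeff P k * (real k * binomial_conv S T \<mu> \<nu> (k - 1)))
      = coeff P k * binomial_conv S T \<mu> (\<lambda>j. real j * \<nu> (j - 1)) k"
    using binomial_conv_parts[of T k S \<mu> \<nu>] by (metis mult.left_commute)
qed

lemma coeff_functional_conv_diff:
  "coeff_functional (binomial_conv S T \<mu> (\<lambda>j. \<nu> j - \<nu>' j)) P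
     = coeff_functional (binomial_conv S T \<mu> \<nu>) P - coeff_functional (binomial_conv S T \<mu> \<nu>') P"
  by (simp add: coeff_functional_def binomial_conv_def sum_subtractf algebra_simps)

section \<open>The normalising constants and the product formula in terms of moments\<close>

lemma jacobi_poly_eq_hyp_poly:
  "jacobi_poly n \<alpha> \<beta> x = poly (hyp_poly n (real n + \<alpha> + \<beta> + 1) (\<alpha> + 1)) ((1 - x) / 2) / fact n"
  by (simp add: jacobi_poly_def poly_hyp_poly add_ac minus_divide_left)

text \<open>
  \<open>Phi k l\<close> as a polynomial in its argument \<open>u S + v T\<close>.
\<close>

definition Phi_poly :: "nat \<Rightarrow> real \<Rightarrow> real poly" where
  "Phi_poly k l = smult (D_const k l / fact k)
     (pcompose (hyp_poly k (real k + 2 * l + 1) (l + 1)) [:1/2, -1/2:])"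

lemma Phi_eq_poly:
  "Phi (int k) l \<theta> \<phi> u v
     = poly (Phi_poly k l) (u * (sin (\<theta>/2) * sin (\<phi>/2)) + v * (cos (\<theta>/2) * cos (\<phi>/2)))"
  by (simp add: Phi_def Phi_poly_def jacobi_poly_eq_hyp_poly poly_pcompose mult_ac add_ac
        diff_divide_distrib)

lemma Gamma_real_duplication:
  assumes "x > (0::real)"
  shows "Gamma (2 * x) = 2 powr (2 * x - 1) * Gamma x * Gamma (x + 1/2) / sqrt pi"
proof -
  have nz: "x \<notin> \<int>\<^sub>\<le>\<^sub>0" "x + 1/2 \<notin> \<int>\<^sub>\<le>\<^sub>0" using assms by (auto elim!: nonpos_Ints_cases)
  have e: "complex_of_real x + 1/2 = of_real (x + 1/2)" "2 * complex_of_real x = of_real (2 * x)"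
    "(1 - complex_of_real (2 * x)) * complex_of_real (ln 2) = of_real ((1 - 2 * x) * ln 2)"
    by simp_all
  have "Gamma (complex_of_real x) * Gamma (complex_of_real x + 1/2)
      = exp ((1 - 2 * complex_of_real x) * of_real (ln 2)) * of_real (sqrt pi) * Gamma (2 * complex_of_real x)"
    by (rule Gamma_legendre_duplication) (use nz in \<open>simp_all only: e of_real_in_nonpos_Ints_iff not_False_eq_True\<close>)
  hence "complex_of_real (Gamma x * Gamma (x + 1/2))
      = complex_of_real (exp ((1 - 2 * x) * ln 2) * sqrt pi * Gamma (2 * x))"
    by (simp only: e Gamma_complex_of_real exp_of_real of_real_mult[symmetric])
  hence "Gamma x * Gamma (x + 1/2) = exp ((1 - 2 * x) * ln 2) * sqrt pi * Gamma (2 * x)"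
    by (simp only: of_real_eq_iff)
  moreover have "2 powr (2 * x - 1) * exp ((1 - 2 * x) * ln 2) = 1"
    by (simp add: powr_def algebra_simps flip: exp_add)
  ultimately show ?thesis by (simp add: mult.assoc)
qed

lemma Gamma_real_plus1: "x > 0 \<Longrightarrow> Gamma (x + 1) = x * Gamma (x::real)"
  by (rule Gamma_plus1) (auto elim!: nonpos_Ints_cases)

text \<open>
  The case \<open>k = 0\<close> stands apart, since \<open>D_const 0\<close> is given by the formula that the
  duplication formula produces from the generic one.
\<close>

lemma D_const_Suc:
  assumes "real k + 2 * l + 2 > 0" "l > -3/2"
  shows "D_const (Suc k) l * (real k + 2 * l + 2) / 2 = 2 * (l + 2) * D_const k (l + 1)"
proof -
  define N where "N = real k + 2 * l + 2"
  have G3: "Gamma (l + 3) = (l + 2) * Gamma (l + 2)"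
    using Gamma_real_plus1[of "l + 2"] assms by (simp add: add_ac)
  have p: "2 powr (2 * l + 3) = 4 * 2 powr (2 * l + 1)"
    by (simp add: powr_add)
  have D: "D_const (Suc k) l = (N + real k + 1) * Gamma N
             / (2 powr (2 * l + 1) * Gamma (l + 2) * Gamma (real k + l + 2))"
    by (simp add: D_const_def N_def add_ac)
  have pos: "l + 2 > 0" using assms by simp
  show ?thesis
  proof (cases "k = 0")
    case False
    have GN: "Gamma (N + 1) = N * Gamma N"
      using Gamma_real_plus1[of N] assms by (simp add: N_def)
    have D': "D_const k (l + 1) = (N + real k + 1) * Gamma (N + 1)
             / (2 powr (2 * l + 3) * Gamma (l + 3) * Gamma (real k + l + 2))"
      using False by (simp add: D_const_def N_def algebra_simps)
    have alg: "x * G / (p * g * h) * N / 2 = 2 * y * (x * (N * G) / (4 * p * (y * g) * h))"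
      if "y > 0" for x G p g h N y :: real
      using that by (simp add: field_simps)
    show ?thesis
      unfolding D D' N_def[symmetric] p G3 GN by (rule alg[OF pos])
  next
    case True
    hence l: "l + 1 > 0" and N: "N = 2 * (l + 1)" using assms by (auto simp: N_def)
    have G: "Gamma (l + 2) = (l + 1) * Gamma (l + 1)" "Gamma (l + 5/2) = (l + 3/2) * Gamma (l + 3/2)"
      using Gamma_real_plus1[of "l + 1"] Gamma_real_plus1[of "l + 3/2"] l by (simp_all add: add_ac)
    have GN: "Gamma N = 2 powr (2 * l + 1) * Gamma (l + 1) * Gamma (l + 3/2) / sqrt pi"
      unfolding N by (subst Gamma_real_duplication[OF l]) (simp add: add_ac)
    have D': "D_const k (l + 1) = Gamma (l + 5/2) / (sqrt pi * Gamma (l + 3))"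
      by (simp add: True D_const_def add_ac)
    have alg: "(2 * x + 1) * (p * g * h / r) / (p * (x * g) * (x * g)) * (2 * x) / 2
        = 2 * y * ((x + 1/2) * h / (r * (y * (x * g))))"
      if "x > 0" "p > 0" "g > 0" "y > 0" "r > 0" for x p g h r y :: real
      using that by (simp add: divide_simps)
    have e: "real k + l + 2 = l + 2" "N + real k + 1 = 2 * (l + 1) + 1" "l + 3/2 = l + 1 + 1/2"
      unfolding True N by simp_all
    have "D_const (Suc k) l * N / 2 = (2 * (l + 1) + 1)
        * (2 powr (2 * l + 1) * Gamma (l + 1) * Gamma (l + 3/2) / sqrt pi)
        / (2 powr (2 * l + 1) * ((l + 1) * Gamma (l + 1)) * ((l + 1) * Gamma (l + 1)))
        * (2 * (l + 1)) / 2"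
      unfolding D e(1,2) GN G(1) by (simp only: N)
    also have "\<dots> = 2 * (l + 2) * ((l + 1 + 1/2) * Gamma (l + 3/2)
                    / (sqrt pi * ((l + 2) * ((l + 1) * Gamma (l + 1)))))"
      by (rule alg) (use l in auto)
    also have "\<dots> = 2 * (l + 2) * D_const k (l + 1)"
      unfolding D' G3 G e(3)[symmetric] ..
    finally show ?thesis unfolding N_def .
  qed
qed

text \<open>
  The derivative of a Jacobi polynomial is again one, with index lowered and both parameters raised
  by one.
\<close>

lemma pderiv_Phi_poly:
  assumes "real k + 2 * l + 2 > 0" "l > -3/2"
  shows "pderiv (Phi_poly (Suc k) l) = smult (2 * (l + 2)) (Phi_poly k (l + 1))"
proof -
  let ?N = "real k + 2 * l + 2" and ?q = "[:1/2, -1/2:]"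
  have N: "real (Suc k) + 2 * l + 1 = ?N" "real k + 2 * (l + 1) + 1 = ?N + 1" by simp_all
  have "pderiv (Phi_poly (Suc k) l)
     = smult (D_const (Suc k) l / fact (Suc k) * (-1/2 * - (real (Suc k) * ?N)))
        (pcompose (hyp_poly k (?N + 1) (l + 1 + 1)) ?q)"
    unfolding Phi_poly_def N pderiv_smult pderiv_pcompose_linear pderiv_hyp_poly pcompose_smult
      smult_smult by (simp only: mult.assoc)
  also have "D_const (Suc k) l / fact (Suc k) * (-1/2 * - (real (Suc k) * ?N))
      = (D_const (Suc k) l * ?N / 2) / fact k"
  proof -
    have "fact (Suc k) = real (Suc k) * fact k" by (simp only: fact_Suc of_nat_mult of_nat_fact)
    moreover have "D / (r * f) * (-1/2 * - (r * N)) = D * N / 2 / f" if "r \<noteq> 0" for D r f N :: real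
      using that by simp
    ultimately show ?thesis by (simp only:)
  qed
  also have "\<dots> = 2 * (l + 2) * (D_const k (l + 1) / fact k)"
    unfolding D_const_Suc[OF assms] by (simp only: times_divide_eq_right)
  finally show ?thesis unfolding Phi_poly_def N smult_smult .
qed

text \<open>
  For \<open>n > 0\<close> this rests on the duplication formula for \<open>\<Gamma> (2 N)\<close> with \<open>N = n + \<alpha> + \<beta> + 1\<close>; for
  \<open>n = 0\<close> both constants are the same quotient of Gamma values.
\<close>

lemma C_const_eq_D_const:
  assumes "\<alpha> > -1" "\<beta> > -1"
  shows "C_const n \<alpha> \<beta> * (4 ^ n * pochhammer (\<alpha> + 1) n * pochhammer (\<beta> + 1) n)
     = D_const (2 * n) (\<alpha> + \<beta> + 1/2) * fact n * pochhammer (real n + \<alpha> + \<beta> + 3/2) n"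
proof (cases "n = 0")
  case True
  thus ?thesis by (simp add: C_const_def D_const_def add_ac)
next
  case False
  define N where "N = real n + \<alpha> + \<beta> + 1"
  have N: "N > 0" using assms False by (simp add: N_def)
  have nonpos: "x \<notin> \<int>\<^sub>\<le>\<^sub>0" if "x > 0" for x :: real
    using that by (auto elim!: nonpos_Ints_cases)
  have poch: "pochhammer x n = Gamma (x + real n) / Gamma x" if "x > 0" for x :: real
    using pochhammer_Gamma[OF nonpos[OF that]] .
  have C: "C_const n \<alpha> \<beta> = Gamma (\<alpha> + 1) * Gamma (\<beta> + 1) * (N + real n) * Gamma N * fact n
     / (sqrt pi * Gamma (\<alpha> + \<beta> + 5/2) * Gamma (\<alpha> + 1 + real n) * Gamma (\<beta> + 1 + real n))"
    using False Gamma_fact[of n, where 'a = real] by (simp add: C_const_def N_def add_ac)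
  have D: "D_const (2 * n) (\<alpha> + \<beta> + 1/2) = 2 * (N + real n) * Gamma (2 * N)
     / (2 powr (2 * (\<alpha> + \<beta> + 1)) * Gamma (\<alpha> + \<beta> + 5/2) * Gamma (N + 1/2 + real n))"
    using False by (simp add: D_const_def N_def algebra_simps)
  have p: "2 powr (2 * N - 1) = 4 ^ n * (2 powr (2 * (\<alpha> + \<beta> + 1)) / 2)"
  proof -
    have "2 powr (2 * N - 1) = 2 powr real (2 * n) * 2 powr (2 * (\<alpha> + \<beta> + 1)) / (2::real)"
      unfolding N_def by (subst powr_add[symmetric]) (simp add: powr_diff powr_add algebra_simps)
    also have "2 powr real (2 * n) = (4::real) ^ n"
      by (subst powr_realpow) (simp_all add: power_mult)
    finally show ?thesis by simp
  qed
  have pos: "Gamma (\<alpha> + 1) > 0" "Gamma (\<beta> + 1) > 0" "Gamma (\<alpha> + 1 + real n) > 0"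
    "Gamma (\<beta> + 1 + real n) > 0" "Gamma (\<alpha> + \<beta> + 5/2) > 0" "Gamma (N + 1/2 + real n) > 0"
    "Gamma (N + 1/2) > 0" "2 powr (2 * (\<alpha> + \<beta> + 1)) > (0::real)"
    using assms N by auto
  have alg1: "a * b * x * G * f / (r * g * a' * b') * (F * (a' / a) * (b' / b)) = x * G * f * F / (r * g)"
    if "a \<noteq> 0" "b \<noteq> 0" "a' \<noteq> 0" "b' \<noteq> 0" for a b a' b' g x G f r F :: real
    using that by simp
  have alg2: "2 * x * (F * (p / 2) * G * h / r) / (p * g * h') * f * (h' / h) = x * G * f * F / (r * g)"
    if "h' \<noteq> 0" "h \<noteq> 0" "p \<noteq> 0" for g h h' p x G f r F :: real
    using that by simp
  have N': "real n + \<alpha> + \<beta> + 3/2 = N + 1/2" by (simp add: N_def)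
  have gt: "\<alpha> + 1 > 0" "\<beta> + 1 > 0" "N + 1/2 > 0" using assms N by auto
  show ?thesis
    unfolding N' C D Gamma_real_duplication[OF N] p poch[OF gt(1)] poch[OF gt(2)] poch[OF gt(3)]
    by (subst alg1; (subst alg2)?; (rule pos[THEN less_imp_neq, symmetric] refl)?)
qed

text \<open>
  The quadratic transformation brings \<open>Phi_poly (2 n)\<close> into the form \<open>\<Sum>j. c\<^sub>j z\<^sup>2\<^sup>j\<close>, with \<open>c\<^sub>j (1/2)\<^sub>j\<close> proportional to
  \<open>(n choose j) (N)\<^sub>j (-1)\<^sup>j\<close>. The moments of \<open>z\<^sup>2\<^sup>j\<close> then make the whole expression the
  left side of Bateman's formula.
\<close>

lemma product_formula_moments:
  fixes \<alpha> \<beta> \<theta> \<phi> :: real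
  assumes "\<alpha> > -1" "\<beta> > -1"
  defines "S \<equiv> sin (\<theta>/2) * sin (\<phi>/2)" and "T \<equiv> cos (\<theta>/2) * cos (\<phi>/2)"
  shows "C_const n \<alpha> \<beta> * jacobi_poly n \<alpha> \<beta> (cos \<theta>) * jacobi_poly n \<alpha> \<beta> (cos \<phi>)
    = coeff_functional (binomial_conv S T (Pi_moment \<alpha>) (Pi_moment \<beta>))
        (Phi_poly (2 * n) (\<alpha> + \<beta> + 1/2))"
proof -
  define s t where "s = (sin (\<theta>/2))\<^sup>2" and "t = (sin (\<phi>/2))\<^sup>2"
  define l where "l = \<alpha> + \<beta> + 1/2"
  define N where "N = real n + (\<alpha> + 1) + (\<beta> + 1) - 1"
  let ?J = "hyp_poly n N (\<alpha> + 1)"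
  let ?D = "D_const (2 * n) l"
  have half: "(1 - cos x) / 2 = (sin (x/2))\<^sup>2" for x :: real
    using cos_double_sin[of "x / 2"] by simp
  have S2: "S\<^sup>2 = s * t" by (simp add: S_def s_def t_def power_mult_distrib)
  have T2: "T\<^sup>2 = (1 - s) * (1 - t)"
    by (simp add: T_def s_def t_def power_mult_distrib cos_squared_eq)
  have jac: "jacobi_poly n \<alpha> \<beta> (cos x) = poly ?J ((sin (x/2))\<^sup>2) / fact n" for x
    unfolding jacobi_poly_eq_hyp_poly half by (simp add: N_def add_ac)
  define B where "B = (\<Sum>j\<le>n. (-1) ^ j * fact j * real (n choose j) * pochhammer N j *
         (\<Sum>i\<le>j. (s * t) ^ i / (fact i * pochhammer (\<alpha> + 1) i) *
            ((1 - s) * (1 - t)) ^ (j - i) / (fact (j - i) * pochhammer (\<beta> + 1) (j - i))))"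
  have bat: "pochhammer (\<alpha> + 1) n * pochhammer (\<beta> + 1) n * B = (-1) ^ n * poly ?J s * poly ?J t"
    unfolding B_def N_def by (rule bateman_product_formula) (use assms in auto)
  have N: "real n + l + 1/2 = N" "2 * real n + 2 * l + 1 = 2 * N" by (simp_all add: N_def l_def)
  have "coeff_functional (binomial_conv S T (Pi_moment \<alpha>) (Pi_moment \<beta>)) (Phi_poly (2 * n) l)
      = ?D / fact (2 * n) * ((-1) ^ n * pochhammer (N + 1/2) n)
         * coeff_functional (\<lambda>j. binomial_conv S T (Pi_moment \<alpha>) (Pi_moment \<beta>) (2 * j)) (hyp_poly n N (1/2))"
  proof -
    have "pcompose (hyp_poly (2 * n) (real (2 * n) + 2 * l + 1) (l + 1)) [:1/2, -1/2:]
        = smult ((-1) ^ n * pochhammer (N + 1/2) n) (pcompose (hyp_poly n N (1/2)) [:0, 0, 1:])"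
      using hyp_poly_quadratic[of l n] assms N(1) by (simp add: l_def N_def add_ac)
    thus ?thesis by (simp only: Phi_poly_def coeff_functional_smult coeff_functional_square mult.assoc)
  qed
  also have "coeff_functional (\<lambda>j. binomial_conv S T (Pi_moment \<alpha>) (Pi_moment \<beta>) (2 * j)) (hyp_poly n N (1/2))
      = pochhammer (1/2) n * B"
  proof -
    have "coeff (hyp_poly n N (1/2)) j * (pochhammer (1/2) j * fact j * x)
        = pochhammer (1/2) n * ((-1) ^ j * fact j * real (n choose j) * pochhammer N j * x)"
      if "j \<le> n" for j x
      by (simp add: coeff_hyp_poly pochhammer_product[OF that, of "1/2 :: real"] mult_ac)
    thus ?thesis
      unfolding coeff_functional_bound[OF degree_hyp_poly] binomial_conv_Pi_moment S2 T2 B_def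
        sum_distrib_left by (intro sum.cong) auto
  qed
  finally have eq: "coeff_functional (binomial_conv S T (Pi_moment \<alpha>) (Pi_moment \<beta>)) (Phi_poly (2 * n) l)
      = ?D / fact (2 * n) * ((-1) ^ n * pochhammer (N + 1/2) n) * (pochhammer (1/2) n * B)" .
  have nz: "pochhammer (\<alpha> + 1) n \<noteq> 0" "pochhammer (\<beta> + 1) n \<noteq> 0" "pochhammer (1/2 :: real) n \<noteq> 0"
    using assms by (auto simp: pochhammer_eq_0_iff)
  have B: "B = (-1) ^ n * poly ?J s * poly ?J t / (pochhammer (\<alpha> + 1) n * pochhammer (\<beta> + 1) n)"
    using bat nz by (simp add: field_simps)
  have C: "C_const n \<alpha> \<beta> = ?D * fact n * pochhammer (N + 1/2) n
             / (4 ^ n * pochhammer (\<alpha> + 1) n * pochhammer (\<beta> + 1) n)"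
    using C_const_eq_D_const[OF assms(1,2), of n] nz
    by (simp add: nonzero_eq_divide_eq l_def N_def add_ac)
  have alg: "D / (F * h * f) * (e * P) * (h * (e * x * y / (a * b))) = D * f * P / (F * a * b) * (x / f) * (y / f)"
    if "e * e = 1" "h \<noteq> 0" "f \<noteq> 0" for D F h f e P x y a b :: real
  proof -
    have "D / (F * h * f) * (e * P) * (h * (e * x * y / (a * b)))
        = (e * e) * (D / (F * h * f) * P * (h * (x * y / (a * b))))" by simp
    also have "\<dots> = D / (F * h * f) * P * (h * (x * y / (a * b)))" by (simp only: that(1) mult_1)
    also have "\<dots> = D * f * P / (F * a * b) * (x / f) * (y / f)" using that(2,3) by (simp add: mult_ac)
    finally show ?thesis .
  qed
  have "?D / fact (2 * n) * ((-1) ^ n * pochhammer (N + 1/2) n) * (pochhammer (1/2) n * B)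
      = C_const n \<alpha> \<beta> * (poly ?J s / fact n) * (poly ?J t / fact n)"
    unfolding B C fact_double of_nat_power of_nat_numeral power_mult
    using alg[of "(-1) ^ n" "pochhammer (1/2) n" "fact n"] nz
    by (simp flip: power_mult_distrib)
  thus ?thesis unfolding jac eq l_def[symmetric] by (simp add: s_def t_def)
qed

section \<open>Moments of the ultraspherical weight\<close>

definition ultraspherical_weight :: "real \<Rightarrow> real \<Rightarrow> real" where
  "ultraspherical_weight a u = (1 - u\<^sup>2) powr (a - 1/2)"

text \<open>
  The factor that makes the ultraspherical weight a probability density on \<open>[-1, 1]\<close> if \<open>a > -1/2\<close>. For
  \<open>-1 < a < -1/2\<close> the weight is not integrable and the factor is negative.
\<close>

definition weight_const :: "real \<Rightarrow> real" where
  "weight_const a = Gamma (a + 1) / (sqrt pi * Gamma (a + 1/2))"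

lemma weight_const_pos: "a > -1/2 \<Longrightarrow> weight_const a > 0"
  by (simp add: weight_const_def)

text \<open>
  The substitution \<open>u = 2 x - 1\<close> gives \<open>1 - u\<^sup>2 = 4 x (1 - x)\<close> and hence a Beta integral.
\<close>

lemma has_integral_ultraspherical_weight:
  assumes "a > -1/2"
  shows "(ultraspherical_weight a has_integral 1 / weight_const a) {-1..1}"
proof -
  define b where "b = a + 1/2"
  have b: "b > 0" using assms by (simp add: b_def)
  let ?f = "\<lambda>t. t powr (b - 1) * (1 - t) powr (b - 1) :: real"
  have "(?f has_integral Beta b b) (cbox 0 1)"
    using has_integral_Beta_real[OF b b] by simp
  hence "((\<lambda>x. ?f ((1/2) *\<^sub>R x + 1/2)) has_integral (Beta b b /\<^sub>R (1/2) ^ DIM(real)))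
      (cbox ((0 - 1/2) /\<^sub>R (1/2)) ((1 - 1/2) /\<^sub>R (1/2)))"
    by (rule has_integral_affinity') simp
  hence "((\<lambda>x. ?f ((1 + x) / 2)) has_integral 2 * Beta b b) {-1..1}"
    by (simp add: field_simps)
  hence "((\<lambda>x. 4 powr (b - 1) * ?f ((1 + x) / 2)) has_integral 4 powr (b - 1) * (2 * Beta b b)) {-1..1}"
    by (rule has_integral_mult_right)
  moreover have "4 powr (b - 1) * ?f ((1 + x) / 2) = ultraspherical_weight a x"
    if "x \<in> {-1..1}" for x
  proof -
    have "4 powr (b - 1) * ?f ((1 + x) / 2) = (4 * ((1 + x) / 2 * (1 - (1 + x) / 2))) powr (b - 1)"
    proof -
      have "(1 + x) / 2 \<ge> 0" "1 - (1 + x) / 2 \<ge> 0" using that by (simp_all add: field_simps)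
      thus ?thesis by (simp only: powr_mult mult_nonneg_nonneg zero_le_numeral)
    qed
    also have "4 * ((1 + x) / 2 * (1 - (1 + x) / 2)) = 1 - x\<^sup>2"
      by (simp add: field_simps power2_eq_square)
    finally show ?thesis by (simp add: ultraspherical_weight_def b_def)
  qed
  ultimately have "(ultraspherical_weight a has_integral 4 powr (b - 1) * (2 * Beta b b)) {-1..1}"
    by (rule has_integral_eq[rotated])
  moreover have "4 powr (b - 1) * (2 * Beta b b) = 1 / weight_const a"
  proof -
    have p: "4 powr (b - 1) * 2 = 2 powr (2 * b - 1)"
    proof -
      have "(4::real) powr (b - 1) = (2 powr 2) powr (b - 1)" by simp
      also have "\<dots> = 2 powr (2 * b - 2)" unfolding powr_powr by (simp add: algebra_simps)
      finally have "4 powr (b - 1) * 2 = 2 powr (2 * b - 2) * 2 powr 1" by simp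
      thus ?thesis unfolding powr_add[symmetric] by simp
    qed
    have alg: "p * (g * g / (p * g * h / r)) = 1 / (h / (r * g))"
      if "p > 0" "g > 0" for p g h r :: real
      using that by simp
    have "4 powr (b - 1) * (2 * Beta b b) = 2 powr (2 * b - 1) * Beta b b"
      using p by simp
    also have "\<dots> = 1 / (Gamma (b + 1/2) / (sqrt pi * Gamma b))"
      unfolding Beta_def mult_2[symmetric] Gamma_real_duplication[OF b]
      by (rule alg) (use b in auto)
    also have "b + 1/2 = a + 1" by (simp add: b_def)
    finally show ?thesis by (simp only: weight_const_def b_def)
  qed
  ultimately show ?thesis by simp
qed

lemma one_minus_square_pos: "u \<in> {-1<..<1} \<Longrightarrow> 1 - u\<^sup>2 > (0::real)"
  using abs_square_less_1[of u] by (simp add: abs_less_iff)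

lemma DERIV_one_minus_square_powr:
  fixes u :: real
  assumes "u \<in> {-1<..<1}"
  shows "((\<lambda>u. (1 - u\<^sup>2) powr c) has_real_derivative - (2 * c * u) * (1 - u\<^sup>2) powr (c - 1)) (at u)"
  using one_minus_square_pos[OF assms]
  by (auto intro!: derivative_eq_intros simp: powr_diff field_simps)

lemma one_minus_square_powr_rec:
  assumes "u \<in> {-1<..<1::real}"
  shows "(1 - u\<^sup>2) powr (a + 1/2) = (1 - u\<^sup>2) * ultraspherical_weight a u"
proof -
  have "(1 - u\<^sup>2) powr (a + 1/2) = (1 - u\<^sup>2) powr (1 + (a - 1/2))" by (simp add: algebra_simps)
  thus ?thesis
    using one_minus_square_pos[OF assms] by (simp only: powr_add powr_one ultraspherical_weight_def)
qed

lemma continuous_on_one_minus_square_powr: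
  assumes "c > 0"
  shows "continuous_on {-1..1} (\<lambda>u::real. (1 - u\<^sup>2) powr c)"
  using assms by (intro continuous_on_powr' continuous_intros)
     (auto simp: abs_square_le_1 abs_le_iff)

text \<open>
  The integrand is the derivative of \<open>u\<^sup>k (1 - u\<^sup>2)\<^sup>a\<^sup>+\<^sup>1\<^sup>/\<^sup>2\<close>, which vanishes at both end points. In terms of
  moments this is a recurrence from order \<open>k - 1\<close> to order \<open>k + 1\<close>.
\<close>

lemma ultraspherical_weight_recurrence:
  assumes "a > -1/2"
  shows "((\<lambda>u. real k * u ^ (k - 1) * ultraspherical_weight a u
            - (real k + 2 * a + 1) * (u ^ Suc k * ultraspherical_weight a u)) has_integral 0) {-1..1}"
proof -
  let ?F = "\<lambda>u::real. u ^ k * (1 - u\<^sup>2) powr (a + 1/2)"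
  have "((\<lambda>u. real k * u ^ (k - 1) * ultraspherical_weight a u
            - (real k + 2 * a + 1) * (u ^ Suc k * ultraspherical_weight a u))
         has_integral (?F 1 - ?F (-1))) {-1..1}"
  proof (rule fundamental_theorem_of_calculus_interior)
    show "continuous_on {-1..1} ?F"
      using assms by (intro continuous_intros continuous_on_one_minus_square_powr) auto
  next
    fix u :: real assume u: "u \<in> {-1<..<1}"
    have "(?F has_real_derivative (real k * u ^ (k - 1)) * (1 - u\<^sup>2) powr (a + 1/2)
        + (- (2 * (a + 1/2) * u) * (1 - u\<^sup>2) powr (a + 1/2 - 1)) * u ^ k) (at u)"
      by (rule DERIV_mult[OF _ DERIV_one_minus_square_powr[OF u]])
         (auto intro!: derivative_eq_intros)
    also have "(real k * u ^ (k - 1)) * (1 - u\<^sup>2) powr (a + 1/2)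
        + (- (2 * (a + 1/2) * u) * (1 - u\<^sup>2) powr (a + 1/2 - 1)) * u ^ k
      = real k * u ^ (k - 1) * ultraspherical_weight a u
            - (real k + 2 * a + 1) * (u ^ Suc k * ultraspherical_weight a u)"
      unfolding one_minus_square_powr_rec[OF u] 
      by (cases k) (simp_all add: ultraspherical_weight_def algebra_simps power2_eq_square)
    finally show "(?F has_vector_derivative real k * u ^ (k - 1) * ultraspherical_weight a u
            - (real k + 2 * a + 1) * (u ^ Suc k * ultraspherical_weight a u)) (at u)"
      by (simp add: has_real_derivative_iff_has_vector_derivative)
  qed simp
  thus ?thesis by simp
qed

lemma has_integral_power_ultraspherical_weight:
  assumes "a > -1/2"
  shows "((\<lambda>u. u ^ k * (weight_const a * ultraspherical_weight a u)) has_integral Pi_moment a k) {-1..1}"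
proof (induction k rule: induct_nat_012)
  case 0
  have "((\<lambda>u. weight_const a * ultraspherical_weight a u)
            has_integral weight_const a * (1 / weight_const a)) {-1..1}"
    by (rule has_integral_mult_right[OF has_integral_ultraspherical_weight[OF assms]])
  thus ?case using weight_const_pos[OF assms] by (simp add: Pi_moment_def)
next
  case 1
  let ?d = "- (2 * a + 1)"
  have "((\<lambda>u. weight_const a / ?d * (?d * (u * ultraspherical_weight a u)))
           has_integral weight_const a / ?d * 0) {-1..1}"
    by (rule has_integral_mult_right)
       (use ultraspherical_weight_recurrence[OF assms, of 0] in \<open>simp add: algebra_simps\<close>)
  moreover have "weight_const a / ?d * (?d * (u * ultraspherical_weight a u))
      = u ^ 1 * (weight_const a * ultraspherical_weight a u)" for u
    using assms by (simp add: field_simps)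
  ultimately show ?case by (simp only: Pi_moment_def) simp
next
  case (ge2 k)
  let ?w = "ultraspherical_weight a" and ?c = "weight_const a" and ?d = "real (Suc k) + 2 * a + 1"
  have d: "?d > 0" using assms by simp
  have "((\<lambda>u. real (Suc k) / ?d * (u ^ k * (?c * ?w u))
      - ?c / ?d * (real (Suc k) * u ^ k * ?w u - ?d * (u ^ Suc (Suc k) * ?w u)))
       has_integral (real (Suc k) / ?d * Pi_moment a k - ?c / ?d * 0)) {-1..1}"
    by (intro has_integral_diff has_integral_mult_right ge2.IH(1))
       (use ultraspherical_weight_recurrence[OF assms, of "Suc k"] in simp)
  moreover have "r / d * (x * (c * w)) - c / d * (r * x * w - d * (y * w)) = y * (c * w)"
    if "d \<noteq> 0" for r d x c w y :: real
    using that by (simp add: field_simps)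
  hence "real (Suc k) / ?d * (u ^ k * (?c * ?w u))
      - ?c / ?d * (real (Suc k) * u ^ k * ?w u - ?d * (u ^ Suc (Suc k) * ?w u))
      = u ^ Suc (Suc k) * (?c * ?w u)" for u
    using d by (metis less_irrefl)
  moreover have "real (Suc k) / ?d * Pi_moment a k = Pi_moment a (Suc (Suc k))"
  proof (cases "even k")
    case True
    then obtain j where k: "k = 2 * j" by (auto elim: evenE)
    have d': "?d = 2 * (a + 1 + real j)" by (simp add: k)
    have j: "real (Suc k) = 2 * (1/2 + real j)" by (simp add: k)
    have alg: "2 * x / (2 * y) * (p / q) = p * x / (q * y)" for x y p q :: real by (simp add: mult.commute)
    have "real (Suc k) / ?d * (pochhammer (1/2) j / pochhammer (a + 1) j)
        = pochhammer (1/2) (Suc j) / pochhammer (a + 1) (Suc j)"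
      unfolding pochhammer_Suc d' unfolding j by (rule alg)
    thus ?thesis by (simp only: k Pi_moment_def) simp
  qed (simp add: Pi_moment_def)
  ultimately show ?case by (simp only: mult_zero_right diff_zero)
qed

lemma ultraspherical_weight_nonneg: "ultraspherical_weight a u \<ge> 0"
  by (simp add: ultraspherical_weight_def)

lemma ultraspherical_weight_measurable [measurable]: "ultraspherical_weight a \<in> borel_measurable borel"
  unfolding ultraspherical_weight_def by measurable

text \<open>
  Bridge from gauge integrals, for which the fundamental theorem holds with derivatives in the
  open interval only, to integrals over the Borel measure \<open>leb_I\<close>.
\<close>

lemma leb_I_integral:
  fixes f :: "real \<Rightarrow> real"
  assumes f: "f absolutely_integrable_on {-1..1}" and m: "f \<in> borel_measurable leb_I"
  shows "integrable leb_I f" and "integral\<^sup>L leb_I f = integral {-1..1} f"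
proof -
  let ?g = "\<lambda>x. indicator {-1..1::real} x *\<^sub>R f x"
  have g: "?g \<in> borel_measurable lborel"
    using m unfolding leb_I_def by (subst (asm) borel_measurable_restrict_space_iff) auto
  have "integrable (completion lborel) ?g" using f unfolding set_integrable_def .
  hence ig: "integrable lborel ?g" using integrable_completion[OF g] by simp
  thus "integrable leb_I f"
    unfolding leb_I_def by (subst integrable_restrict_space) auto
  have "integral\<^sup>L leb_I f = integral\<^sup>L lborel ?g"
    unfolding leb_I_def by (subst integral_restrict_space) auto
  also have "\<dots> = integral {-1..1} f"
    using set_borel_integral_eq_integral(2)[of "{-1..1}" f] ig
    by (simp add: set_integrable_def set_lebesgue_integral_def)
  finally show "integral\<^sup>L leb_I f = integral {-1..1} f" .
qed

text \<open>
  The signed measure with density \<open>p\<close> with respect to \<open>M\<close> has the moments \<open>\<mu>\<close>, all of them finite.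
\<close>

definition has_moments :: "real measure \<Rightarrow> (real \<Rightarrow> real) \<Rightarrow> (nat \<Rightarrow> real) \<Rightarrow> bool" where
  "has_moments M p \<mu> \<longleftrightarrow> (\<forall>k. has_bochner_integral M (\<lambda>u. u ^ k * p u) (\<mu> k))"

lemma abs_power_le_one:
  "u \<in> {-1..1} \<Longrightarrow> \<bar>u ^ k :: real\<bar> \<le> 1"
  by (simp add: power_abs power_le_one abs_le_iff)

lemma has_moments_ultraspherical_weight:
  assumes "a > -1/2"
  shows "has_moments leb_I (\<lambda>u. weight_const a * ultraspherical_weight a u) (Pi_moment a)"
  unfolding has_moments_def
proof
  fix k
  let ?f = "\<lambda>u. u ^ k * (weight_const a * ultraspherical_weight a u)"
  have "?f absolutely_integrable_on {-1..1}"
  proof (rule absolutely_integrable_integrable_bound)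
    show "?f integrable_on {-1..1}"
      using has_integral_power_ultraspherical_weight[OF assms] by blast
    show "(\<lambda>u. u ^ 0 * (weight_const a * ultraspherical_weight a u)) integrable_on {-1..1}"
      using has_integral_power_ultraspherical_weight[OF assms] by blast
    fix u :: real assume "u \<in> {-1..1}"
    thus "norm (?f u) \<le> u ^ 0 * (weight_const a * ultraspherical_weight a u)"
      using weight_const_pos[OF assms] ultraspherical_weight_nonneg[of a u] abs_power_le_one[of u k]
      by (simp add: abs_mult mult_left_le_one_le)
  qed
  moreover have "?f \<in> borel_measurable leb_I"
    unfolding leb_I_def by (rule measurable_restrict_space1) simp
  ultimately have "integrable leb_I ?f" "integral\<^sup>L leb_I ?f = integral {-1..1} ?f"
    by (rule leb_I_integral)+
  moreover have "integral {-1..1} ?f = Pi_moment a k"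
    by (rule integral_unique[OF has_integral_power_ultraspherical_weight[OF assms]])
  ultimately show "has_bochner_integral leb_I ?f (Pi_moment a k)"
    unfolding has_bochner_integral_iff by (simp only: simp_thms)
qed

section \<open>The function \<open>\<Pi>\<^sub>\<alpha>\<close> and its moments\<close>

lemma continuous_on_ultraspherical_weight: "continuous_on {-1<..<1} (ultraspherical_weight a)"
proof -
  have "1 - u\<^sup>2 \<noteq> 0" if "u \<in> {-1<..<1}" for u :: real
    using one_minus_square_pos[OF that] by simp
  thus ?thesis unfolding ultraspherical_weight_def by (intro continuous_intros) auto
qed

lemma DERIV_Pi_fun:
  assumes u: "u \<in> {-1<..<1}"
  shows "(Pi_fun \<alpha> has_real_derivative weight_const \<alpha> * ultraspherical_weight \<alpha> u) (at u)"
proof -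
  \<comment> \<open>The weight is unbounded at \<open>-1\<close> and \<open>1\<close> for small parameters, so the fundamental theorem is applied on a compact interval \<open>[-r, r]\<close> around \<open>u\<close>.\<close>
  define r where "r = (1 + \<bar>u\<bar>) / 2"
  have r: "\<bar>u\<bar> < r" "r < 1" using u by (auto simp: r_def abs_less_iff)
  have sub: "{-r..r} \<subseteq> {-1<..<1}" using r by auto
  have "((\<lambda>u. LBINT y=0..u. ultraspherical_weight \<alpha> y) has_vector_derivative
          ultraspherical_weight \<alpha> u) (at u within {-r..r})"
    using r continuous_on_subset[OF continuous_on_ultraspherical_weight sub]
    by (simp only: zero_ereal_def) (intro interval_integral_FTC2; auto simp: abs_less_iff)
  moreover have "at u within {-r..r} = at u"
    using r by (intro at_within_interior) (auto simp: abs_less_iff)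
  ultimately have "((\<lambda>u. LBINT y=0..u. ultraspherical_weight \<alpha> y) has_real_derivative
      ultraspherical_weight \<alpha> u) (at u)"
    by (simp add: has_real_derivative_iff_has_vector_derivative)
  hence "((\<lambda>u. weight_const \<alpha> * (LBINT y=0..u. ultraspherical_weight \<alpha> y)) has_real_derivative
      weight_const \<alpha> * ultraspherical_weight \<alpha> u) (at u)"
    by (rule DERIV_cmult)
  moreover have "Pi_fun \<alpha> = (\<lambda>u. weight_const \<alpha> * (LBINT y=0..u. ultraspherical_weight \<alpha> y))"
    by (rule ext) (simp add: Pi_fun_def weight_const_def ultraspherical_weight_def)
  ultimately show ?thesis by simp
qed

text \<open>
  The primitive of the weight that vanishes at \<open>0\<close>. It is based at the end point \<open>-1\<close> so
  that its continuity on the closed interval is immediate.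
\<close>

definition weight_primitive :: "real \<Rightarrow> real \<Rightarrow> real" where
  "weight_primitive a u = integral {-1..u} (ultraspherical_weight a) - 1 / (2 * weight_const a)"

lemma DERIV_weight_primitive:
  assumes a: "a > -1/2" and u: "u \<in> {-1<..<1}"
  shows "(weight_primitive a has_real_derivative ultraspherical_weight a u) (at u)"
proof -
  define r where "r = (1 + \<bar>u\<bar>) / 2"
  have r: "\<bar>u\<bar> < r" "r < 1" using u by (auto simp: r_def abs_less_iff)
  have sub: "{-r..r} \<subseteq> {-1<..<1}" using r by auto
  have int: "ultraspherical_weight a integrable_on {-1..1}"
    using has_integral_ultraspherical_weight[OF a] by blast
  have "((\<lambda>x. integral {-r..x} (ultraspherical_weight a)) has_real_derivative
          ultraspherical_weight a u) (at u within {-r..r})"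
    using r continuous_on_subset[OF continuous_on_ultraspherical_weight sub]
    by (intro integral_has_real_derivative) (auto simp: abs_less_iff)
  moreover have within: "at u within {-r..r} = at u"
    using r by (intro at_within_interior) (auto simp: abs_less_iff)
  ultimately have "((\<lambda>x. integral {-r..x} (ultraspherical_weight a)) has_real_derivative
          ultraspherical_weight a u) (at u)" by simp
  hence "((\<lambda>x. integral {-r..x} (ultraspherical_weight a)
       + (integral {-1..-r} (ultraspherical_weight a) - 1 / (2 * weight_const a))) has_real_derivative
          ultraspherical_weight a u + 0) (at u)"
    by (rule DERIV_add[OF _ DERIV_const])
  hence "((\<lambda>x. integral {-r..x} (ultraspherical_weight a)
       + (integral {-1..-r} (ultraspherical_weight a) - 1 / (2 * weight_const a))) has_real_derivative
          ultraspherical_weight a u) (at u)" by simp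
  thus ?thesis
  proof (rule has_field_derivative_transform_within_open)
    show "open {-r<..<r}" "u \<in> {-r<..<r}" using r by (auto simp: abs_less_iff)
    fix x assume x: "x \<in> {-r<..<r}"
    have "ultraspherical_weight a integrable_on {-1..x}"
      by (rule integrable_on_subinterval[OF int]) (use x r in auto)
    hence "integral {-1..-r} (ultraspherical_weight a) + integral {-r..x} (ultraspherical_weight a)
        = integral {-1..x} (ultraspherical_weight a)"
      using x r by (intro Henstock_Kurzweil_Integration.integral_combine) auto
    thus "integral {-r..x} (ultraspherical_weight a)
       + (integral {-1..-r} (ultraspherical_weight a) - 1 / (2 * weight_const a)) = weight_primitive a x"
      by (simp add: weight_primitive_def)
  qed
qed

lemma weight_primitive_continuous:
  assumes "a > -1/2"
  shows "continuous_on {-1..1} (weight_primitive a)"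
  unfolding weight_primitive_def using has_integral_ultraspherical_weight[OF assms]
  by (intro continuous_intros indefinite_integral_continuous_1) blast

text \<open>
  The weight is even, so each half of the interval carries half of its mass.
\<close>

lemma weight_primitive_values:
  assumes "a > -1/2"
  shows "weight_primitive a (-1) = - 1 / (2 * weight_const a)"
    and "weight_primitive a 0 = 0"
    and "weight_primitive a 1 = 1 / (2 * weight_const a)"
proof -
  let ?w = "ultraspherical_weight a"
  have int: "?w integrable_on {-1..1}" and tot: "integral {-1..1} ?w = 1 / weight_const a"
    using has_integral_ultraspherical_weight[OF assms] by (auto simp: integral_unique)
  have "integral {-1..0} ?w + integral {0..1} ?w = integral {-1..1} ?w"
    by (rule Henstock_Kurzweil_Integration.integral_combine[OF _ _ int]) auto
  moreover have "integral {-1..0} ?w = integral {0..1} ?w"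
  proof -
    have "?w (- u) = ?w u" for u by (simp add: ultraspherical_weight_def)
    thus ?thesis using Henstock_Kurzweil_Integration.integral_reflect_real[of 1 0 ?w] by simp
  qed
  ultimately have "integral {-1..0} ?w = 1 / (2 * weight_const a)" using tot by simp
  thus "weight_primitive a 0 = 0" by (simp add: weight_primitive_def)
  show "weight_primitive a (-1) = - 1 / (2 * weight_const a)"
    by (simp add: weight_primitive_def)
  show "weight_primitive a 1 = 1 / (2 * weight_const a)"
    unfolding weight_primitive_def tot by simp
qed

lemma weight_const_Suc:
  assumes "-1 < \<alpha>" "\<alpha> < -1/2"
  shows "weight_const \<alpha> * (2 * (\<alpha> + 1)) = weight_const (\<alpha> + 1) * (2 * \<alpha> + 1)"
proof -
  have n1: "\<alpha> + 1 \<notin> \<int>\<^sub>\<le>\<^sub>0" using assms by (auto elim!: nonpos_Ints_cases)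
  have n2: "\<alpha> + 1/2 \<notin> \<int>\<^sub>\<le>\<^sub>0"
  proof
    assume "\<alpha> + 1/2 \<in> \<int>\<^sub>\<le>\<^sub>0"
    then obtain k where "\<alpha> + 1/2 = of_int k" by (auto elim!: nonpos_Ints_cases)
    hence "real_of_int (-1) < of_int k" "real_of_int k < of_int 0" using assms by auto
    thus False unfolding of_int_less_iff by simp
  qed
  have G: "Gamma (\<alpha> + 1 + 1) = (\<alpha> + 1) * Gamma (\<alpha> + 1)"
    "Gamma (\<alpha> + 1 + 1/2) = (\<alpha> + 1/2) * Gamma (\<alpha> + 1/2)"
    using Gamma_plus1[OF n1] Gamma_plus1[OF n2] by (simp_all add: add_ac)
  have nz: "Gamma (\<alpha> + 1/2) \<noteq> 0" using n2 by (simp add: Gamma_eq_zero_iff)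
  have "\<alpha> + 1/2 \<noteq> 0" using assms by simp
  have alg: "g / (r * h) * (2 * x) = x * g / (r * (y * h)) * (2 * y)" if "y \<noteq> 0" for g h r x y :: real
    using that by simp
  have "2 * \<alpha> + 1 = 2 * (\<alpha> + 1/2)" by simp
  thus ?thesis unfolding weight_const_def G using alg[OF \<open>\<alpha> + 1/2 \<noteq> 0\<close>] by (simp only:)
qed

text \<open>
  For \<open>\<alpha> < -1/2\<close> the density of \<open>\<Pi>\<^sub>\<alpha>\<close> is not integrable up to the end points. Differentiating
  \<open>u (1 - u\<^sup>2)\<^sup>\<alpha>\<^sup>+\<^sup>1\<^sup>/\<^sup>2\<close> expresses it through the weight with parameter \<open>\<alpha> + 1 > 0\<close>, which is
  integrable. This splits \<open>\<Pi>\<^sub>\<alpha>\<close> into a continuous function and \<open>u\<close> times an integrable weight.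
\<close>

lemma Pi_fun_eq_primitive:
  assumes \<alpha>: "-1 < \<alpha>" "\<alpha> < -1/2" and u: "u \<in> {-1<..<1}"
  shows "Pi_fun \<alpha> u = weight_const (\<alpha> + 1) *
    (weight_primitive (\<alpha> + 1) u - u * ultraspherical_weight (\<alpha> + 1) u / (2 * (\<alpha> + 1)))"
proof -
  define a where "a = \<alpha> + 1"
  have a: "a > 0" using \<alpha> by (simp add: a_def)
  let ?Q = "\<lambda>u. weight_const a * (weight_primitive a u - u * ultraspherical_weight a u / (2 * a))"
  have D: "((\<lambda>u. Pi_fun \<alpha> u - ?Q u) has_real_derivative 0) (at u within {-1<..<1})"
    if u: "u \<in> {-1<..<1}" for u
  proof -
    let ?p = "(1 - u\<^sup>2) powr (a - 1/2 - 1)"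
    have w: "ultraspherical_weight a u = (1 - u\<^sup>2) * ?p"
    proof -
      have "(1 - u\<^sup>2) powr (1 + (a - 1/2 - 1)) = (1 - u\<^sup>2) * ?p"
        using one_minus_square_pos[OF u] by (simp only: powr_add powr_one)
      thus ?thesis by (simp add: ultraspherical_weight_def)
    qed
    have Dw: "(ultraspherical_weight a has_real_derivative - (2 * (a - 1/2) * u) * ?p) (at u)"
      using DERIV_one_minus_square_powr[OF u, of "a - 1/2"]
      unfolding ultraspherical_weight_def[abs_def] .
    have "(?Q has_real_derivative weight_const a * (ultraspherical_weight a u
           - (1 * ultraspherical_weight a u + (- (2 * (a - 1/2) * u) * ?p) * u) / (2 * a))) (at u)"
      by (intro DERIV_cmult DERIV_diff DERIV_weight_primitive DERIV_cdivide DERIV_mult DERIV_ident Dw u)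
         (use a in simp)
    also have "weight_const a * (ultraspherical_weight a u
           - (1 * ultraspherical_weight a u + (- (2 * (a - 1/2) * u) * ?p) * u) / (2 * a))
        = weight_const a * (2 * \<alpha> + 1) / (2 * a) * ?p"
      unfolding w using a by (simp add: a_def divide_simps) (simp add: algebra_simps power2_eq_square)
    also have "weight_const a * (2 * \<alpha> + 1) / (2 * a) = weight_const \<alpha>"
      using weight_const_Suc[OF \<alpha>] a by (simp add: a_def divide_simps)
    also have "weight_const \<alpha> * ?p = weight_const \<alpha> * ultraspherical_weight \<alpha> u"
      by (simp add: a_def ultraspherical_weight_def)
    finally have "((\<lambda>u. Pi_fun \<alpha> u - ?Q u) has_real_derivative
        weight_const \<alpha> * ultraspherical_weight \<alpha> u - weight_const \<alpha> * ultraspherical_weight \<alpha> u) (at u)"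
      by (rule DERIV_diff[OF DERIV_Pi_fun[OF u]])
    thus ?thesis by (simp add: has_field_derivative_at_within)
  qed
  have "\<exists>c. \<forall>u\<in>{-1<..<1}. Pi_fun \<alpha> u - ?Q u = c"
    by (rule has_field_derivative_zero_constant[OF _ D]) auto
  then obtain c where c: "Pi_fun \<alpha> u - ?Q u = c" if "u \<in> {-1<..<1}" for u by blast
  have "Pi_fun \<alpha> 0 - ?Q 0 = 0"
    using weight_primitive_values(2)[of a] a by (simp add: Pi_fun_def zero_ereal_def)
  hence "c = 0" using c[of 0] by simp
  thus ?thesis using c[OF u] by (simp add: a_def)
qed

text \<open>
  The moments of \<open>\<Pi>\<^sub>\<alpha>(u) du\<close>, in the form dictated by integration by parts.
\<close>

definition Pi_fun_moment :: "real \<Rightarrow> nat \<Rightarrow> real" where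
  "Pi_fun_moment \<alpha> k = (even_moment (Suc k) - Pi_moment \<alpha> (Suc k)) / real (Suc k)"

lemma Pi_fun_moment_parts:
  "real j * Pi_fun_moment \<alpha> (j - 1) = even_moment j - Pi_moment \<alpha> j"
  by (cases j) (simp_all add: Pi_fun_moment_def even_moment_def Pi_moment_def)

text \<open>
  Integration by parts: \<open>k + 1\<close> times the integrand is the derivative of the product of \<open>u\<^sup>k\<^sup>+\<^sup>1\<close> and the
  normalised primitive, diminished by the product of \<open>u\<^sup>k\<^sup>+\<^sup>1\<close> and the normalised weight.
\<close>

lemma has_integral_power_weight_primitive:
  assumes "a > -1/2"
  shows "((\<lambda>u. u ^ k * (weight_const a * weight_primitive a u)) has_integral
            (even_moment (Suc k) - Pi_moment a (Suc k)) / real (Suc k)) {-1..1}"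
proof -
  let ?c = "weight_const a" and ?W = "weight_primitive a" and ?w = "ultraspherical_weight a"
  let ?F = "\<lambda>u. u ^ Suc k * (?c * ?W u)"
  have "((\<lambda>u. real (Suc k) * u ^ k * (?c * ?W u) + ?c * ?w u * u ^ Suc k)
          has_integral (?F 1 - ?F (-1))) {-1..1}"
  proof (rule fundamental_theorem_of_calculus_interior)
    show "continuous_on {-1..1} ?F"
      by (intro continuous_intros weight_primitive_continuous assms)
  next
    fix u :: real assume u: "u \<in> {-1<..<1}"
    have "(?F has_real_derivative (real (Suc k) * u ^ k) * (?c * ?W u) + (?c * ?w u) * u ^ Suc k) (at u)"
      by (rule DERIV_mult[OF _ DERIV_cmult[OF DERIV_weight_primitive[OF assms u]]])
         (use DERIV_pow[of "Suc k" u UNIV] in simp)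
    thus "(?F has_vector_derivative real (Suc k) * u ^ k * (?c * ?W u) + ?c * ?w u * u ^ Suc k) (at u)"
      by (simp add: has_real_derivative_iff_has_vector_derivative)
  qed simp
  moreover have "?F 1 - ?F (-1) = even_moment (Suc k)"
    using weight_const_pos[OF assms]
    by (simp add: weight_primitive_values[OF assms] even_moment_def)
  ultimately have "((\<lambda>u. (real (Suc k) * u ^ k * (?c * ?W u) + ?c * ?w u * u ^ Suc k)
        - u ^ Suc k * (?c * ?w u)) has_integral (even_moment (Suc k) - Pi_moment a (Suc k))) {-1..1}"
    by (intro has_integral_diff has_integral_power_ultraspherical_weight assms) (simp only:)
  hence "((\<lambda>u. 1 / real (Suc k) * ((real (Suc k) * u ^ k * (?c * ?W u) + ?c * ?w u * u ^ Suc k)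
        - u ^ Suc k * (?c * ?w u))) has_integral
          1 / real (Suc k) * (even_moment (Suc k) - Pi_moment a (Suc k))) {-1..1}"
    by (rule has_integral_mult_right)
  moreover have "1 / r * ((r * x * y + z * t) - t * z) = x * y" if "r \<noteq> 0" for r x y z t :: real
    using that by simp
  hence "1 / real (Suc k) * ((real (Suc k) * u ^ k * (?c * ?W u) + ?c * ?w u * u ^ Suc k)
        - u ^ Suc k * (?c * ?w u)) = u ^ k * (?c * ?W u)" for u
    by (metis of_nat_neq_0)
  ultimately show ?thesis by simp
qed

lemma weight_primitive_measurable:
  assumes "a > -1/2"
  shows "weight_primitive a \<in> borel_measurable leb_I"
  unfolding leb_I_def
  using borel_measurable_continuous_on_restrict[OF weight_primitive_continuous[OF assms]]
  by (simp cong: measurable_cong_sets add: sets_restrict_space)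

lemma borel_measurable_leb_I: "f \<in> borel_measurable borel \<Longrightarrow> f \<in> borel_measurable leb_I"
  unfolding leb_I_def by (rule measurable_restrict_space1) simp

lemma has_bochner_integral_power_weight_primitive:
  assumes "a > -1/2"
  shows "has_bochner_integral leb_I (\<lambda>u. u ^ k * (weight_const a * weight_primitive a u))
           ((even_moment (Suc k) - Pi_moment a (Suc k)) / real (Suc k))"
proof -
  let ?f = "\<lambda>u. u ^ k * (weight_const a * weight_primitive a u)"
  have "?f absolutely_integrable_on {-1..1}"
    by (intro absolutely_integrable_continuous_real continuous_intros weight_primitive_continuous assms)
  moreover have "?f \<in> borel_measurable leb_I"
    by (intro borel_measurable_times borel_measurable_leb_I[of "\<lambda>u. u ^ k"]
        weight_primitive_measurable assms) auto
  ultimately have "integrable leb_I ?f" "integral\<^sup>L leb_I ?f = integral {-1..1} ?f"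
    by (rule leb_I_integral)+
  moreover have "integral {-1..1} ?f = (even_moment (Suc k) - Pi_moment a (Suc k)) / real (Suc k)"
    by (rule integral_unique[OF has_integral_power_weight_primitive[OF assms]])
  ultimately show ?thesis
    unfolding has_bochner_integral_iff by (simp only: simp_thms)
qed

text \<open>
  Both parts of the decomposition of \<open>\<Pi>\<^sub>\<alpha>\<close> have known moments in terms of \<open>Pi_moment (\<alpha> + 1)\<close>; the identity
  \<open>(a)\<^sub>j (a + j) = a (a + 1)\<^sub>j\<close> for \<open>a = \<alpha> + 1\<close> recombines them into \<open>Pi_moment \<alpha>\<close>.
\<close>

lemma has_bochner_integral_power_Pi_primitive:
  assumes \<alpha>: "-1 < \<alpha>" "\<alpha> < -1/2"
  shows "has_bochner_integral leb_I (\<lambda>u. u ^ k * (weight_const (\<alpha> + 1) *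
      (weight_primitive (\<alpha> + 1) u - u * ultraspherical_weight (\<alpha> + 1) u / (2 * (\<alpha> + 1)))))
     (Pi_fun_moment \<alpha> k)"
proof -
  define a where "a = \<alpha> + 1"
  have a: "a > 0" "a > -1/2" using \<alpha> by (simp_all add: a_def)
  let ?c = "weight_const a" and ?W = "weight_primitive a" and ?w = "ultraspherical_weight a"
  have w: "has_bochner_integral leb_I (\<lambda>u. u ^ Suc k * (?c * ?w u)) (Pi_moment a (Suc k))"
    using has_moments_ultraspherical_weight[OF a(2)] unfolding has_moments_def by blast
  have "has_bochner_integral leb_I
      (\<lambda>u. u ^ k * (?c * ?W u) - 1 / (2 * a) * (u ^ Suc k * (?c * ?w u)))
      ((even_moment (Suc k) - Pi_moment a (Suc k)) / real (Suc k)
        - 1 / (2 * a) * Pi_moment a (Suc k))"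
    by (intro has_bochner_integral_diff has_bochner_integral_mult_right
        has_bochner_integral_power_weight_primitive w a)
  moreover have "u ^ k * (?c * ?W u) - 1 / (2 * a) * (u ^ Suc k * (?c * ?w u))
      = u ^ k * (?c * (?W u - u * ?w u / (2 * a)))" for u
    by (simp add: algebra_simps)
  moreover have "(even_moment (Suc k) - Pi_moment a (Suc k)) / real (Suc k)
        - 1 / (2 * a) * Pi_moment a (Suc k) = Pi_fun_moment \<alpha> k"
  proof (cases "even (Suc k)")
    case True
    then obtain j where j: "Suc k = 2 * j" by (rule evenE)
    have pos: "pochhammer (a + 1) j > 0" "pochhammer a j > 0" using a by (auto intro: pochhammer_pos)
    have "a * pochhammer (a + 1) j = pochhammer a j * (a + real j)"
      by (metis pochhammer_Suc pochhammer_rec)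
    hence "pochhammer (1/2) j / pochhammer (a + 1) j * (a + real j) / a
        = pochhammer (1/2) j / pochhammer a j"
      using pos a by (simp add: divide_simps mult_ac)
    hence "Pi_moment \<alpha> (Suc k) = Pi_moment a (Suc k) * (a + real j) / a"
      by (simp add: Pi_moment_def j a_def)
    hence m: "Pi_moment \<alpha> (Suc k) = Pi_moment a (Suc k) * (a + real j) / a" .
    have "j > 0" and r: "real (Suc k) = 2 * real j" using j by (auto intro: gr0I)
    have alg: "(e - m) / (2 * y) - 1 / (2 * a) * m = (e - m * (a + y) / a) / (2 * y)"
      if "y > 0" for e m y :: real
      using that a by (simp add: field_simps)
    show ?thesis unfolding Pi_fun_moment_def m r by (rule alg) (use \<open>j > 0\<close> in simp)
  qed (simp add: even_moment_def Pi_moment_def Pi_fun_moment_def)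
  ultimately show ?thesis by (simp add: a_def)
qed

lemma AE_leb_I_interior: "AE u in leb_I. u \<in> {-1<..<1}"
proof -
  have "AE u in lborel. u \<noteq> (1::real)" "AE u in lborel. u \<noteq> (-1::real)"
    by (rule AE_lborel_singleton)+
  hence "AE u in lborel. u \<in> {-1..1::real} \<longrightarrow> u \<in> {-1<..<1}" by eventually_elim auto
  thus ?thesis unfolding leb_I_def by (subst AE_restrict_space_iff) auto
qed

lemma space_leb_I: "space leb_I = {-1..1}"
  by (simp add: leb_I_def space_restrict_space)

text \<open>
  \<open>Pi_fun \<alpha>\<close> agrees with the explicit decomposition only inside the interval; its values at the two
  end points matter for measurability, but not for the integral.
\<close>

lemma has_moments_Pi_fun:
  assumes \<alpha>: "-1 < \<alpha>" "\<alpha> < -1/2"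
  shows "has_moments leb_I (Pi_fun \<alpha>) (Pi_fun_moment \<alpha>)"
  unfolding has_moments_def
proof
  fix k
  let ?Q = "\<lambda>u. weight_const (\<alpha> + 1) *
      (weight_primitive (\<alpha> + 1) u - u * ultraspherical_weight (\<alpha> + 1) u / (2 * (\<alpha> + 1)))"
  have Qm: "?Q \<in> borel_measurable leb_I"
    by (intro borel_measurable_times borel_measurable_diff borel_measurable_const
        borel_measurable_leb_I[of "\<lambda>u. u * ultraspherical_weight (\<alpha> + 1) u / (2 * (\<alpha> + 1))"]
        weight_primitive_measurable) (use \<alpha> in auto)
  \<comment> \<open>Only the two end point values separate \<open>Pi_fun \<alpha>\<close> from the measurable \<open>?Q\<close>.\<close>
  have "(\<lambda>u. indicator {-1<..<1} u * ?Q u + indicator {1} u * Pi_fun \<alpha> 1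
      + indicator {-1} u * Pi_fun \<alpha> (-1)) \<in> borel_measurable leb_I"
    by (intro borel_measurable_times borel_measurable_add borel_measurable_const Qm
        borel_measurable_leb_I[of "indicator A" for A] borel_measurable_indicator) auto
  also have "?this \<longleftrightarrow> Pi_fun \<alpha> \<in> borel_measurable leb_I"
    by (rule measurable_cong)
       (use Pi_fun_eq_primitive[OF \<alpha>] in \<open>auto simp: space_leb_I indicator_def\<close>)
  finally have Pm: "Pi_fun \<alpha> \<in> borel_measurable leb_I" .
  have pow: "(\<lambda>u. u ^ k) \<in> borel_measurable leb_I" by (rule borel_measurable_leb_I) simp
  have "has_bochner_integral leb_I (\<lambda>u. u ^ k * ?Q u) (Pi_fun_moment \<alpha> k)"
    by (rule has_bochner_integral_power_Pi_primitive[OF \<alpha>])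
  moreover have "AE u in leb_I. u ^ k * ?Q u = u ^ k * Pi_fun \<alpha> u"
    using AE_leb_I_interior by eventually_elim (simp only: Pi_fun_eq_primitive[OF \<alpha>])
  ultimately show "has_bochner_integral leb_I (\<lambda>u. u ^ k * Pi_fun \<alpha> u) (Pi_fun_moment \<alpha> k)"
    by (subst has_bochner_integral_cong_AE[of _ _ "\<lambda>u. u ^ k * ?Q u"])
       (auto intro!: borel_measurable_times pow Qm Pm elim: eventually_mono)
qed

section \<open>Moments of \<open>d\<Pi>\<^sub>\<alpha>\<close>\<close>

lemma has_moments_dPi_density:
  assumes "\<alpha> > -1/2"
  shows "has_moments (dPi \<alpha>) (\<lambda>_. 1) (Pi_moment \<alpha>)"
  unfolding has_moments_def
proof
  fix k
  let ?g = "\<lambda>u. indicator {-1<..<1} u * (weight_const \<alpha> * ultraspherical_weight \<alpha> u) :: real"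
  have "indicator {-1<..<1} u * deriv (Pi_fun \<alpha>) u = ?g u" for u
    using DERIV_imp_deriv[OF DERIV_Pi_fun[of u \<alpha>]] by (cases "u \<in> {-1<..<1}") simp_all
  hence "(\<lambda>u. ennreal (indicator {-1<..<1} u * deriv (Pi_fun \<alpha>) u)) = (\<lambda>u. ennreal (?g u))"
    by (simp only:)
  hence dPi: "dPi \<alpha> = density leb_I (\<lambda>u. ennreal (?g u))"
    using assms by (simp only: dPi_def) simp
  have gm: "?g \<in> borel_measurable leb_I" by (rule borel_measurable_leb_I) simp
  have fm: "(\<lambda>u. u ^ k * 1 :: real) \<in> borel_measurable leb_I" by (rule borel_measurable_leb_I) simp
  have nn: "AE u in leb_I. 0 \<le> ?g u"
    using weight_const_pos[OF assms] ultraspherical_weight_nonneg[of \<alpha>] by (simp add: indicator_def)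
  have eq: "?g u *\<^sub>R (u ^ k * 1) = u ^ k * (weight_const \<alpha> * ultraspherical_weight \<alpha> u)"
    if "u \<in> space leb_I" for u
  proof (cases "u \<in> {-1<..<1}")
    case False
    with that have "u = 1 \<or> u = -1" by (auto simp: space_leb_I)
    thus ?thesis by (auto simp: ultraspherical_weight_def)
  qed simp
  have "has_bochner_integral leb_I (\<lambda>u. u ^ k * (weight_const \<alpha> * ultraspherical_weight \<alpha> u)) (Pi_moment \<alpha> k)"
    using has_moments_ultraspherical_weight[OF assms] unfolding has_moments_def by blast
  hence "has_bochner_integral leb_I (\<lambda>u. ?g u *\<^sub>R (u ^ k * 1)) (Pi_moment \<alpha> k)"
    by (subst has_bochner_integral_cong[OF refl eq refl])
  thus "has_bochner_integral (dPi \<alpha>) (\<lambda>u. u ^ k * 1) (Pi_moment \<alpha> k)"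
    unfolding dPi has_bochner_integral_iff integrable_density[OF fm gm nn] integral_density[OF fm gm nn] .
qed

lemma Pi_moment_half: "Pi_moment (-1/2) = even_moment"
proof
  fix k
  have "pochhammer (1/2 :: real) j \<noteq> 0" for j by (auto simp: pochhammer_eq_0_iff)
  thus "Pi_moment (-1/2) k = even_moment k" by (simp add: Pi_moment_def even_moment_def)
qed

text \<open>
  Up to a null set every function on \<open>[-1, 1]\<close> is a combination of the indicators of the two end
  points.
\<close>

lemma has_moments_half_deltas: "has_moments half_deltas (\<lambda>_. 1) even_moment"
  unfolding has_moments_def
proof
  fix k
  let ?R = "restrict_space borel {-1..1::real}"
  have sets: "sets half_deltas = sets ?R"
    unfolding half_deltas_def using sets.sigma_algebra_axioms[of ?R] sets.space_closed[of ?R]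
    by (subst sets_measure_of) (auto simp: space_restrict_space sigma_algebra.sigma_sets_eq)
  have sp: "space half_deltas = {-1..1}"
    using sets_eq_imp_space_eq[OF sets] by (simp add: space_restrict_space)
  have meas: "(\<lambda>u. u ^ k * 1) \<in> borel_measurable half_deltas"
    using measurable_restrict_space1[of "\<lambda>u::real. u ^ k * 1" borel borel "{-1..1}"]
    by (simp cong: measurable_cong_sets add: sets)
  have in_sets: "A \<in> sets ?R" if "A \<in> sets borel" "A \<subseteq> {-1..1}" for A
    using that by (subst sets_restrict_space_iff) auto
  have half: "has_bochner_integral half_deltas (indicator {c} :: real \<Rightarrow> real) (1/2)"
    if "c = 1 \<or> c = -1" for c
  proof -
    have c: "{c} \<in> sets ?R" using that by (intro in_sets) auto
    have e: "emeasure half_deltas {c} = ennreal (1/2)"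
    proof -
      have "(1::ennreal) / 2 = ennreal (1/2)"
        by (metis divide_ennreal ennreal_1 ennreal_numeral zero_le_one zero_less_numeral zero_le_numeral)
      thus ?thesis using that by (subst emeasure_half_deltas[OF c]) (auto simp: indicator_def)
    qed
    have m: "measure half_deltas {c} = 1/2"
      unfolding measure_def e by (rule enn2real_ennreal) simp
    have "{c} \<in> sets half_deltas" "emeasure half_deltas {c} < \<infinity>"
      using c by (simp_all only: sets e infinity_ennreal_def ennreal_less_top)
    thus ?thesis
      using has_bochner_integral_real_indicator[of "{c}" half_deltas] unfolding m by blast
  qed
  let ?N = "{-1..1} - {-1, 1::real}"
  have N: "?N \<in> sets ?R" by (intro in_sets) auto
  have "emeasure half_deltas ?N = 0"
    by (subst emeasure_half_deltas[OF N]) (simp add: indicator_def)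
  hence "AE u in half_deltas. u \<notin> ?N"
    using N by (intro AE_not_in) (auto simp: null_sets_def sets)
  hence ae: "AE u in half_deltas. (-1) ^ k * indicator {-1} u + 1 * indicator {1} u = (u ^ k * 1 :: real)"
    using AE_space by eventually_elim (auto simp: sp indicator_def)
  have b: "has_bochner_integral half_deltas (\<lambda>u. (-1) ^ k * indicator {-1} u + 1 * indicator {1} u :: real)
      ((-1) ^ k * (1/2) + 1 * (1/2))"
    by (intro has_bochner_integral_add has_bochner_integral_mult_right half) auto
  have "has_bochner_integral half_deltas (\<lambda>u. u ^ k * 1) ((-1) ^ k * (1/2) + 1 * (1/2))"
    using has_bochner_integral_cong_AE[OF borel_measurable_has_bochner_integral[OF b] meas ae] b
    by blast
  thus "has_bochner_integral half_deltas (\<lambda>u. u ^ k * 1) (even_moment k)"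
    by (simp add: even_moment_def minus_one_power_iff split: if_splits)
qed

lemma has_moments_dPi:
  assumes "\<alpha> \<ge> -1/2"
  shows "has_moments (dPi \<alpha>) (\<lambda>_. 1) (Pi_moment \<alpha>)"
proof (cases "\<alpha> = -1/2")
  case True
  thus ?thesis using has_moments_half_deltas by (simp add: dPi_def Pi_moment_half[symmetric])
next
  case False
  thus ?thesis using has_moments_dPi_density assms by simp
qed

lemma has_moments_imp_finite_measure:
  assumes "has_moments M (\<lambda>_. 1) \<mu>"
  shows "finite_measure M"
proof
  have "integrable M (\<lambda>u. u ^ 0 * 1 :: real)"
    using assms unfolding has_moments_def has_bochner_integral_iff by blast
  hence "(\<integral>\<^sup>+ u. ennreal (norm (1::real)) \<partial>M) < \<infinity>" unfolding integrable_iff_bounded by simp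
  thus "emeasure M (space M) \<noteq> \<infinity>" by simp
qed

lemma finite_measure_leb_I: "finite_measure leb_I"
  by (rule finite_measureI) (simp add: space_leb_I, simp add: leb_I_def emeasure_restrict_space)

section \<open>Integrals over product measures\<close>

lemma has_bochner_integral_pair_mult:
  fixes f g :: "real \<Rightarrow> real"
  assumes "sigma_finite_measure M" "sigma_finite_measure N"
    and f: "has_bochner_integral M f x" and g: "has_bochner_integral N g y"
  shows "has_bochner_integral (M \<Otimes>\<^sub>M N) (\<lambda>(u, v). f u * g v) (x * y)"
proof -
  interpret M: sigma_finite_measure M by fact
  interpret N: sigma_finite_measure N by fact
  interpret pair_sigma_finite M N ..
  have fi: "integrable M f" "integral\<^sup>L M f = x" and gi: "integrable N g" "integral\<^sup>L N g = y"
    using f g by (auto simp: has_bochner_integral_iff)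
  note [measurable] = borel_measurable_integrable[OF fi(1)] borel_measurable_integrable[OF gi(1)]
  have int: "integrable (M \<Otimes>\<^sub>M N) (\<lambda>(u, v). f u * g v)"
  proof (rule Fubini_integrable)
    show "(\<lambda>(u, v). f u * g v) \<in> borel_measurable (M \<Otimes>\<^sub>M N)" by measurable
    show "integrable M (\<lambda>u. \<integral> v. norm (case (u, v) of (u, v) \<Rightarrow> f u * g v) \<partial>N)"
      using fi(1) by (simp add: abs_mult)
    show "AE u in M. integrable N (\<lambda>v. case (u, v) of (u, v) \<Rightarrow> f u * g v)"
      using gi(1) by simp
  qed
  have "integral\<^sup>L (M \<Otimes>\<^sub>M N) (\<lambda>(u, v). f u * g v) = (\<integral>u. \<integral>v. f u * g v \<partial>N \<partial>M)"
    using integral_fst'[OF int] by simp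
  also have "\<dots> = x * y" using fi gi by simp
  finally show ?thesis using int by (simp add: has_bochner_integral_iff)
qed

lemma has_bochner_integral_pair_poly:
  assumes sf: "sigma_finite_measure M" "sigma_finite_measure N"
    and M: "has_moments M p \<mu>" and N: "has_moments N q \<nu>"
  shows "has_bochner_integral (M \<Otimes>\<^sub>M N) (\<lambda>(u, v). poly P (u * S + v * T) * p u * q v)
           (coeff_functional (binomial_conv S T \<mu> \<nu>) P)"
proof -
  have "has_bochner_integral (M \<Otimes>\<^sub>M N) (\<lambda>z. \<Sum>k\<le>degree P. coeff P k *
      (\<Sum>i\<le>k. (real (k choose i) * S ^ i * T ^ (k - i)) *
         (case z of (u, v) \<Rightarrow> (u ^ i * p u) * (v ^ (k - i) * q v))))
      (\<Sum>k\<le>degree P. coeff P k *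
      (\<Sum>i\<le>k. (real (k choose i) * S ^ i * T ^ (k - i)) * (\<mu> i * \<nu> (k - i))))"
    using M N unfolding has_moments_def
    by (intro has_bochner_integral_sum has_bochner_integral_mult_right
        has_bochner_integral_pair_mult sf) auto
  also have "(\<Sum>k\<le>degree P. coeff P k *
      (\<Sum>i\<le>k. (real (k choose i) * S ^ i * T ^ (k - i)) * (\<mu> i * \<nu> (k - i))))
      = coeff_functional (binomial_conv S T \<mu> \<nu>) P"
    by (simp add: coeff_functional_def binomial_conv_def mult.assoc)
  also have "(\<lambda>z. \<Sum>k\<le>degree P. coeff P k *
      (\<Sum>i\<le>k. (real (k choose i) * S ^ i * T ^ (k - i)) *
         (case z of (u, v) \<Rightarrow> (u ^ i * p u) * (v ^ (k - i) * q v))))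
      = (\<lambda>(u, v). poly P (u * S + v * T) * p u * q v)"
  proof
    fix z :: "real \<times> real"
    obtain u v where z: "z = (u, v)" by (cases z)
    have "(\<Sum>i\<le>k. (real (k choose i) * S ^ i * T ^ (k - i)) * ((u ^ i * p u) * (v ^ (k - i) * q v)))
        = (u * S + v * T) ^ k * (p u * q v)" for k
      unfolding binomial_ring sum_distrib_right
      by (intro sum.cong refl) (simp add: power_mult_distrib mult_ac)
    thus "(\<Sum>k\<le>degree P. coeff P k * (\<Sum>i\<le>k. (real (k choose i) * S ^ i * T ^ (k - i)) *
        (case z of (u, v) \<Rightarrow> (u ^ i * p u) * (v ^ (k - i) * q v))))
       = (case z of (u, v) \<Rightarrow> poly P (u * S + v * T) * p u * q v)"
      by (simp add: z poly_altdef sum_distrib_right mult.assoc)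
  qed
  finally show ?thesis .
qed

lemma has_bochner_integral_pair_poly_scaled:
  assumes "sigma_finite_measure M" "sigma_finite_measure N"
    and "has_moments M p \<mu>" and "has_moments N q \<nu>"
  shows "has_bochner_integral (M \<Otimes>\<^sub>M N) (\<lambda>(u, v). c * poly P (u * S + v * T) * p u * q v)
           (c * coeff_functional (binomial_conv S T \<mu> \<nu>) P)"
  using has_bochner_integral_pair_poly[OF assms, of "smult c P" S T]
  by (simp add: coeff_functional_smult)

text \<open>
  For \<open>n = 0\<close> the derivative of the constant \<open>Phi_poly 0 l\<close> matches the convention that \<open>Phi\<close> vanishes at
  negative indices.
\<close>

lemma pderiv_Phi_poly_even:
  assumes "l > -3/2"
  shows "poly (pderiv (Phi_poly (2 * n) l)) (u * (sin (\<theta>/2) * sin (\<phi>/2)) + v * (cos (\<theta>/2) * cos (\<phi>/2)))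
      = 2 * (l + 2) * Phi (2 * int n - 1) (l + 1) \<theta> \<phi> u v" (is ?A)
    and "poly (pderiv (pderiv (Phi_poly (2 * n) l)))
          (u * (sin (\<theta>/2) * sin (\<phi>/2)) + v * (cos (\<theta>/2) * cos (\<phi>/2)))
      = 4 * (l + 2) * (l + 3) * Phi (2 * int n - 2) (l + 2) \<theta> \<phi> u v" (is ?B)
proof -
  have "?A \<and> ?B"
  proof (cases n)
    case 0
    have "pderiv (Phi_poly 0 l) = 0"
      by (simp add: Phi_poly_def hyp_poly_def monom_0 pderiv_pCons pderiv_smult)
    thus ?thesis by (simp add: 0 Phi_def)
  next
    case (Suc m)
    have i: "2 * int n - 1 = int (Suc (2 * m))" "2 * int n - 2 = int (2 * m)"
      and n: "2 * n = Suc (Suc (2 * m))"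
      by (simp_all add: Suc)
    have p1: "pderiv (Phi_poly (2 * n) l) = smult (2 * (l + 2)) (Phi_poly (Suc (2 * m)) (l + 1))"
      unfolding n using assms by (intro pderiv_Phi_poly) auto
    have "pderiv (Phi_poly (Suc (2 * m)) (l + 1)) = smult (2 * (l + 1 + 2)) (Phi_poly (2 * m) (l + 1 + 1))"
      using assms by (intro pderiv_Phi_poly) auto
    hence p2: "pderiv (pderiv (Phi_poly (2 * n) l))
        = smult (2 * (l + 2) * (2 * (l + 3))) (Phi_poly (2 * m) (l + 2))"
      unfolding p1 pderiv_smult by (simp add: add_ac)
    show ?thesis
      unfolding i Phi_eq_poly p2 unfolding p1 by (simp add: algebra_simps)
  qed
  thus ?A ?B by auto
qed

text \<open>
  Replacing \<open>Pi_moment \<beta>\<close> by the moments of the half unit masses is corrected by a term with one derivative of \<open>P\<close>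
  and the moments of \<open>\<Pi>\<^sub>\<beta>(v) dv\<close>.
\<close>

lemma coeff_functional_parts_right:
  "T * coeff_functional (binomial_conv S T \<mu> (Pi_fun_moment \<beta>)) (pderiv P)
     = coeff_functional (binomial_conv S T \<mu> even_moment) P
       - coeff_functional (binomial_conv S T \<mu> (Pi_moment \<beta>)) P"
  by (simp only: coeff_functional_pderiv_conv Pi_fun_moment_parts coeff_functional_conv_diff)

lemma coeff_functional_parts_left:
  "S * coeff_functional (binomial_conv S T (Pi_fun_moment \<alpha>) \<nu>) (pderiv P)
     = coeff_functional (binomial_conv S T even_moment \<nu>) P
       - coeff_functional (binomial_conv S T (Pi_moment \<alpha>) \<nu>) P"
proof -
  have "binomial_conv S T \<mu> \<nu> = binomial_conv T S \<nu> \<mu>" for \<mu>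
    by (rule ext) (rule binomial_conv_swap)
  thus ?thesis by (simp only: coeff_functional_parts_right)
qed

theorem theorem3p2:
  fixes n :: nat and \<alpha> \<beta> \<theta> \<phi> :: real
  assumes "0 \<le> \<theta>" "\<theta> \<le> pi" "0 \<le> \<phi>" "\<phi> \<le> pi"
  shows
    "(\<alpha> \<ge> -1/2 \<and> \<beta> \<ge> -1/2 \<longrightarrow>
       (let f = (\<lambda>(u, v). Phi (2 * int n) (\<alpha> + \<beta> + 1/2) \<theta> \<phi> u v)
        in integrable (dPi \<alpha> \<Otimes>\<^sub>M dPi \<beta>) f \<and>
           C_const n \<alpha> \<beta> * jacobi_poly n \<alpha> \<beta> (cos \<theta>) * jacobi_poly n \<alpha> \<beta> (cos \<phi>)
             = (\<integral>z. f z \<partial>(dPi \<alpha> \<Otimes>\<^sub>M dPi \<beta>))))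
   \<and> (-1 < \<beta> \<and> \<beta> < -1/2 \<and> -1/2 \<le> \<alpha> \<longrightarrow>
       (let f = (\<lambda>(u, v). -2 * (\<alpha> + \<beta> + 5/2) * cos (\<theta>/2) * cos (\<phi>/2)
                  * Phi (2 * int n - 1) (\<alpha> + \<beta> + 3/2) \<theta> \<phi> u v * Pi_fun \<beta> v);
            g = (\<lambda>(u, v). Phi (2 * int n) (\<alpha> + \<beta> + 1/2) \<theta> \<phi> u v)
        in integrable (dPi \<alpha> \<Otimes>\<^sub>M leb_I) f \<and>
           integrable (dPi \<alpha> \<Otimes>\<^sub>M dPi (-1/2)) g \<and>
           C_const n \<alpha> \<beta> * jacobi_poly n \<alpha> \<beta> (cos \<theta>) * jacobi_poly n \<alpha> \<beta> (cos \<phi>)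
             = (\<integral>z. f z \<partial>(dPi \<alpha> \<Otimes>\<^sub>M leb_I))
             + (\<integral>z. g z \<partial>(dPi \<alpha> \<Otimes>\<^sub>M dPi (-1/2)))))
   \<and> (-1 < \<alpha> \<and> \<alpha> < -1/2 \<and> -1/2 \<le> \<beta> \<longrightarrow>
       (let f = (\<lambda>(u, v). -2 * (\<alpha> + \<beta> + 5/2) * sin (\<theta>/2) * sin (\<phi>/2)
                  * Phi (2 * int n - 1) (\<alpha> + \<beta> + 3/2) \<theta> \<phi> u v * Pi_fun \<alpha> u);
            g = (\<lambda>(u, v). Phi (2 * int n) (\<alpha> + \<beta> + 1/2) \<theta> \<phi> u v)
        in integrable (leb_I \<Otimes>\<^sub>M dPi \<beta>) f \<and>
           integrable (dPi (-1/2) \<Otimes>\<^sub>M dPi \<beta>) g \<and>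
           C_const n \<alpha> \<beta> * jacobi_poly n \<alpha> \<beta> (cos \<theta>) * jacobi_poly n \<alpha> \<beta> (cos \<phi>)
             = (\<integral>z. f z \<partial>(leb_I \<Otimes>\<^sub>M dPi \<beta>))
             + (\<integral>z. g z \<partial>(dPi (-1/2) \<Otimes>\<^sub>M dPi \<beta>))))
   \<and> (-1 < \<alpha> \<and> \<alpha> < -1/2 \<and> -1 < \<beta> \<and> \<beta> < -1/2 \<longrightarrow>
       (let f = (\<lambda>(u, v). (\<alpha> + \<beta> + 5/2) * (\<alpha> + \<beta> + 7/2) * sin \<theta> * sin \<phi>
                  * Phi (2 * int n - 2) (\<alpha> + \<beta> + 5/2) \<theta> \<phi> u v * Pi_fun \<alpha> u * Pi_fun \<beta> v);
            g = (\<lambda>(u, v). -2 * (\<alpha> + \<beta> + 5/2) * sin (\<theta>/2) * sin (\<phi>/2)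
                  * Phi (2 * int n - 1) (\<alpha> + \<beta> + 3/2) \<theta> \<phi> u v * Pi_fun \<alpha> u);
            h = (\<lambda>(u, v). -2 * (\<alpha> + \<beta> + 5/2) * cos (\<theta>/2) * cos (\<phi>/2)
                  * Phi (2 * int n - 1) (\<alpha> + \<beta> + 3/2) \<theta> \<phi> u v * Pi_fun \<beta> v);
            k = (\<lambda>(u, v). Phi (2 * int n) (\<alpha> + \<beta> + 1/2) \<theta> \<phi> u v)
        in integrable (leb_I \<Otimes>\<^sub>M leb_I) f \<and>
           integrable (leb_I \<Otimes>\<^sub>M dPi (-1/2)) g \<and>
           integrable (dPi (-1/2) \<Otimes>\<^sub>M leb_I) h \<and>
           integrable (dPi (-1/2) \<Otimes>\<^sub>M dPi (-1/2)) k \<and>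
           C_const n \<alpha> \<beta> * jacobi_poly n \<alpha> \<beta> (cos \<theta>) * jacobi_poly n \<alpha> \<beta> (cos \<phi>)
             = (\<integral>z. f z \<partial>(leb_I \<Otimes>\<^sub>M leb_I))
             + (\<integral>z. g z \<partial>(leb_I \<Otimes>\<^sub>M dPi (-1/2)))
             + (\<integral>z. h z \<partial>(dPi (-1/2) \<Otimes>\<^sub>M leb_I))
             + (\<integral>z. k z \<partial>(dPi (-1/2) \<Otimes>\<^sub>M dPi (-1/2)))))"
proof -
  define l where "l = \<alpha> + \<beta> + 1/2"
  define S where "S = sin (\<theta>/2) * sin (\<phi>/2)"
  define T where "T = cos (\<theta>/2) * cos (\<phi>/2)"
  define P where "P = Phi_poly (2 * n) l"
  define B where "B = (\<lambda>\<mu> \<nu> P. coeff_functional (binomial_conv S T \<mu> \<nu>) P)"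
  let ?PP = "C_const n \<alpha> \<beta> * jacobi_poly n \<alpha> \<beta> (cos \<theta>) * jacobi_poly n \<alpha> \<beta> (cos \<phi>)"
  have product: "?PP = B (Pi_moment \<alpha>) (Pi_moment \<beta>) P" if "\<alpha> > -1" "\<beta> > -1"
    unfolding B_def P_def l_def S_def T_def by (rule product_formula_moments[OF that])
  have right: "T * B \<mu> (Pi_fun_moment \<beta>) (pderiv Q) = B \<mu> even_moment Q - B \<mu> (Pi_moment \<beta>) Q" for \<mu> Q
    unfolding B_def by (rule coeff_functional_parts_right)
  have left: "S * B (Pi_fun_moment \<alpha>) \<nu> (pderiv Q) = B even_moment \<nu> Q - B (Pi_moment \<alpha>) \<nu> Q" for \<nu> Q
    unfolding B_def by (rule coeff_functional_parts_left)
  have Phi0: "Phi (2 * int n) (\<alpha> + \<beta> + 1/2) \<theta> \<phi> u v = poly P (u * S + v * T)" for u v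
    using Phi_eq_poly[of "2 * n" l \<theta> \<phi> u v] by (simp add: P_def S_def T_def l_def)
  have Phi1: "2 * (\<alpha> + \<beta> + 5/2) * Phi (2 * int n - 1) (\<alpha> + \<beta> + 3/2) \<theta> \<phi> u v
      = poly (pderiv P) (u * S + v * T)"
    and Phi2: "4 * (\<alpha> + \<beta> + 5/2) * (\<alpha> + \<beta> + 7/2) * Phi (2 * int n - 2) (\<alpha> + \<beta> + 5/2) \<theta> \<phi> u v
      = poly (pderiv (pderiv P)) (u * S + v * T)" if "\<alpha> > -1" "\<beta> > -1" for u v
  proof -
    have l: "l > -3/2" using that by (simp add: l_def)
    have e: "\<alpha> + \<beta> + 5/2 = l + 2" "\<alpha> + \<beta> + 3/2 = l + 1" "\<alpha> + \<beta> + 7/2 = l + 3"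
      by (simp_all add: l_def)
    show "2 * (\<alpha> + \<beta> + 5/2) * Phi (2 * int n - 1) (\<alpha> + \<beta> + 3/2) \<theta> \<phi> u v
      = poly (pderiv P) (u * S + v * T)"
      unfolding e P_def S_def T_def by (rule pderiv_Phi_poly_even(1)[OF l, symmetric])
    show "4 * (\<alpha> + \<beta> + 5/2) * (\<alpha> + \<beta> + 7/2) * Phi (2 * int n - 2) (\<alpha> + \<beta> + 5/2) \<theta> \<phi> u v
      = poly (pderiv (pderiv P)) (u * S + v * T)"
      unfolding e P_def S_def T_def by (rule pderiv_Phi_poly_even(2)[OF l, symmetric])
  qed
  have sf_dPi: "sigma_finite_measure (dPi \<gamma>)" if "\<gamma> \<ge> -1/2" for \<gamma>
    using has_moments_imp_finite_measure[OF has_moments_dPi[OF that]] by (rule finite_measure.axioms(1))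
  have sf_leb: "sigma_finite_measure leb_I"
    using finite_measure_leb_I by (rule finite_measure.axioms(1))
  have hm_half: "has_moments (dPi (-1/2)) (\<lambda>_. 1) even_moment"
    using has_moments_dPi[of "-1/2"] by (simp only: Pi_moment_half order_refl)
  note sf_half = sf_dPi[of "-1/2", OF order_refl]
  have int: "has_bochner_integral (M \<Otimes>\<^sub>M N) (\<lambda>(u, v). c * poly Q (u * S + v * T) * p u * q v) (c * B \<mu> \<nu> Q)"
    if "sigma_finite_measure M" "sigma_finite_measure N" "has_moments M p \<mu>" "has_moments N q \<nu>"
    for M N p q \<mu> \<nu> c Q
    unfolding B_def by (rule has_bochner_integral_pair_poly_scaled[OF that])
  have half: "-1 < \<gamma>" if "\<gamma> \<ge> -1/2" for \<gamma> :: real using that by simp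

  \<comment> \<open>The summands that occur in the four cases, each evaluated by means of the moments with the integration by parts undone.\<close>
  have term0: "has_bochner_integral (M \<Otimes>\<^sub>M N) (\<lambda>(u, v). Phi (2 * int n) (\<alpha> + \<beta> + 1/2) \<theta> \<phi> u v) (B \<mu> \<nu> P)"
    if "sigma_finite_measure M" "sigma_finite_measure N" "has_moments M (\<lambda>_. 1) \<mu>" "has_moments N (\<lambda>_. 1) \<nu>"
    for M N \<mu> \<nu>
    using int[OF that, of 1 P] by (simp only: Phi0 mult_1 mult_1_right)
  have term_cos: "has_bochner_integral (M \<Otimes>\<^sub>M leb_I) (\<lambda>(u, v). -2 * (\<alpha> + \<beta> + 5/2) * cos (\<theta>/2) * cos (\<phi>/2)
        * Phi (2 * int n - 1) (\<alpha> + \<beta> + 3/2) \<theta> \<phi> u v * Pi_fun \<beta> v)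
      (B \<mu> (Pi_moment \<beta>) P - B \<mu> even_moment P)"
    if "sigma_finite_measure M" "has_moments M (\<lambda>_. 1) \<mu>" and ab: "-1 < \<alpha>" "-1 < \<beta>" "\<beta> < -1/2" for M \<mu>
  proof -
    have "-2 * (\<alpha> + \<beta> + 5/2) * cos (\<theta>/2) * cos (\<phi>/2)
        * Phi (2 * int n - 1) (\<alpha> + \<beta> + 3/2) \<theta> \<phi> u v * Pi_fun \<beta> v
        = - T * (2 * (\<alpha> + \<beta> + 5/2) * Phi (2 * int n - 1) (\<alpha> + \<beta> + 3/2) \<theta> \<phi> u v)
            * 1 * Pi_fun \<beta> v" for u v
      unfolding T_def by (simp add: algebra_simps)
    note this[unfolded Phi1[OF ab(1,2)]]
    moreover have "- T * B \<mu> (Pi_fun_moment \<beta>) (pderiv P) = B \<mu> (Pi_moment \<beta>) P - B \<mu> even_moment P"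
      using right[of \<mu> P] by simp
    ultimately show ?thesis
      using int[OF that(1) sf_leb that(2) has_moments_Pi_fun[OF ab(2,3)], of "- T" "pderiv P"]
      by (simp only:)
  qed
  have term_sin: "has_bochner_integral (leb_I \<Otimes>\<^sub>M N) (\<lambda>(u, v). -2 * (\<alpha> + \<beta> + 5/2) * sin (\<theta>/2) * sin (\<phi>/2)
        * Phi (2 * int n - 1) (\<alpha> + \<beta> + 3/2) \<theta> \<phi> u v * Pi_fun \<alpha> u)
      (B (Pi_moment \<alpha>) \<nu> P - B even_moment \<nu> P)"
    if "sigma_finite_measure N" "has_moments N (\<lambda>_. 1) \<nu>" and ab: "-1 < \<alpha>" "\<alpha> < -1/2" "-1 < \<beta>" for N \<nu>
  proof -
    have "-2 * (\<alpha> + \<beta> + 5/2) * sin (\<theta>/2) * sin (\<phi>/2)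
        * Phi (2 * int n - 1) (\<alpha> + \<beta> + 3/2) \<theta> \<phi> u v * Pi_fun \<alpha> u
        = - S * (2 * (\<alpha> + \<beta> + 5/2) * Phi (2 * int n - 1) (\<alpha> + \<beta> + 3/2) \<theta> \<phi> u v)
            * Pi_fun \<alpha> u * 1" for u v
      unfolding S_def by (simp add: algebra_simps)
    note this[unfolded Phi1[OF ab(1,3)]]
    moreover have "- S * B (Pi_fun_moment \<alpha>) \<nu> (pderiv P) = B (Pi_moment \<alpha>) \<nu> P - B even_moment \<nu> P"
      using left[of \<nu> P] by simp
    ultimately show ?thesis
      using int[OF sf_leb that(1) has_moments_Pi_fun[OF ab(1,2)] that(2), of "- S" "pderiv P"]
      by (simp only:)
  qed
  have term_both: "has_bochner_integral (leb_I \<Otimes>\<^sub>M leb_I) (\<lambda>(u, v). (\<alpha> + \<beta> + 5/2) * (\<alpha> + \<beta> + 7/2)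
        * sin \<theta> * sin \<phi> * Phi (2 * int n - 2) (\<alpha> + \<beta> + 5/2) \<theta> \<phi> u v * Pi_fun \<alpha> u * Pi_fun \<beta> v)
      (B even_moment even_moment P - B (Pi_moment \<alpha>) even_moment P
        - (B even_moment (Pi_moment \<beta>) P - B (Pi_moment \<alpha>) (Pi_moment \<beta>) P))"
    if ab: "-1 < \<alpha>" "\<alpha> < -1/2" "-1 < \<beta>" "\<beta> < -1/2"
  proof -
    have sin2: "sin x = 2 * sin (x/2) * cos (x/2)" for x :: real
      using sin_double[of "x/2"] by simp
    have "(\<alpha> + \<beta> + 5/2) * (\<alpha> + \<beta> + 7/2)
        * sin \<theta> * sin \<phi> * Phi (2 * int n - 2) (\<alpha> + \<beta> + 5/2) \<theta> \<phi> u v * Pi_fun \<alpha> u * Pi_fun \<beta> v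
        = S * T * (4 * (\<alpha> + \<beta> + 5/2) * (\<alpha> + \<beta> + 7/2)
            * Phi (2 * int n - 2) (\<alpha> + \<beta> + 5/2) \<theta> \<phi> u v) * Pi_fun \<alpha> u * Pi_fun \<beta> v" for u v
      unfolding S_def T_def sin2[of \<theta>] sin2[of \<phi>] by simp
    note this[unfolded Phi2[OF ab(1,3)]]
    moreover have "S * T * B (Pi_fun_moment \<alpha>) (Pi_fun_moment \<beta>) (pderiv (pderiv P))
      = B even_moment even_moment P - B (Pi_moment \<alpha>) even_moment P
        - (B even_moment (Pi_moment \<beta>) P - B (Pi_moment \<alpha>) (Pi_moment \<beta>) P)"
      unfolding mult.assoc right right_diff_distrib left ..
    ultimately show ?thesis
      using int[OF sf_leb sf_leb has_moments_Pi_fun[OF ab(1,2)] has_moments_Pi_fun[OF ab(3,4)],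
          of "S * T" "pderiv (pderiv P)"]
      by (simp only:)
  qed
  note iff = has_bochner_integral_iff

  show ?thesis
    unfolding Let_def
  proof (intro conjI[of "_ \<longrightarrow> _"] impI; elim conjE)
    assume ab: "-1/2 \<le> \<alpha>" "-1/2 \<le> \<beta>"
    note i = term0[OF sf_dPi sf_dPi has_moments_dPi has_moments_dPi, OF ab ab, unfolded iff]
    show "integrable (dPi \<alpha> \<Otimes>\<^sub>M dPi \<beta>) (\<lambda>(u, v). Phi (2 * int n) (\<alpha> + \<beta> + 1/2) \<theta> \<phi> u v) \<and>
      ?PP = (\<integral>z. (case z of (u, v) \<Rightarrow> Phi (2 * int n) (\<alpha> + \<beta> + 1/2) \<theta> \<phi> u v) \<partial>(dPi \<alpha> \<Otimes>\<^sub>M dPi \<beta>))"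
      unfolding product[OF ab[THEN half]] using i by simp
  next
    assume ab: "-1 < \<beta>" "\<beta> < -1/2" "-1/2 \<le> \<alpha>"
    note i = term_cos[OF sf_dPi has_moments_dPi, OF ab(3) ab(3) half[OF ab(3)] ab(1,2), unfolded iff]
      term0[OF sf_dPi sf_half has_moments_dPi hm_half, OF ab(3) ab(3), unfolded iff]
    show "integrable (dPi \<alpha> \<Otimes>\<^sub>M leb_I) (\<lambda>(u, v). -2 * (\<alpha> + \<beta> + 5/2) * cos (\<theta>/2) * cos (\<phi>/2)
                  * Phi (2 * int n - 1) (\<alpha> + \<beta> + 3/2) \<theta> \<phi> u v * Pi_fun \<beta> v) \<and>
           integrable (dPi \<alpha> \<Otimes>\<^sub>M dPi (-1/2)) (\<lambda>(u, v). Phi (2 * int n) (\<alpha> + \<beta> + 1/2) \<theta> \<phi> u v) \<and>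
           ?PP = (\<integral>z. (case z of (u, v) \<Rightarrow> -2 * (\<alpha> + \<beta> + 5/2) * cos (\<theta>/2) * cos (\<phi>/2)
                  * Phi (2 * int n - 1) (\<alpha> + \<beta> + 3/2) \<theta> \<phi> u v * Pi_fun \<beta> v) \<partial>(dPi \<alpha> \<Otimes>\<^sub>M leb_I))
             + (\<integral>z. (case z of (u, v) \<Rightarrow> Phi (2 * int n) (\<alpha> + \<beta> + 1/2) \<theta> \<phi> u v) \<partial>(dPi \<alpha> \<Otimes>\<^sub>M dPi (-1/2)))"
      unfolding product[OF half[OF ab(3)] ab(1)] i[THEN conjunct2] using i[THEN conjunct1] by simp
  next
    assume ab: "-1 < \<alpha>" "\<alpha> < -1/2" "-1/2 \<le> \<beta>"
    note i = term_sin[OF sf_dPi has_moments_dPi, OF ab(3) ab(3) ab(1,2) half[OF ab(3)], unfolded iff]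
      term0[OF sf_half sf_dPi hm_half has_moments_dPi, OF ab(3) ab(3), unfolded iff]
    show "integrable (leb_I \<Otimes>\<^sub>M dPi \<beta>) (\<lambda>(u, v). -2 * (\<alpha> + \<beta> + 5/2) * sin (\<theta>/2) * sin (\<phi>/2)
                  * Phi (2 * int n - 1) (\<alpha> + \<beta> + 3/2) \<theta> \<phi> u v * Pi_fun \<alpha> u) \<and>
           integrable (dPi (-1/2) \<Otimes>\<^sub>M dPi \<beta>) (\<lambda>(u, v). Phi (2 * int n) (\<alpha> + \<beta> + 1/2) \<theta> \<phi> u v) \<and>
           ?PP = (\<integral>z. (case z of (u, v) \<Rightarrow> -2 * (\<alpha> + \<beta> + 5/2) * sin (\<theta>/2) * sin (\<phi>/2)
                  * Phi (2 * int n - 1) (\<alpha> + \<beta> + 3/2) \<theta> \<phi> u v * Pi_fun \<alpha> u) \<partial>(leb_I \<Otimes>\<^sub>M dPi \<beta>))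
             + (\<integral>z. (case z of (u, v) \<Rightarrow> Phi (2 * int n) (\<alpha> + \<beta> + 1/2) \<theta> \<phi> u v) \<partial>(dPi (-1/2) \<Otimes>\<^sub>M dPi \<beta>))"
      unfolding product[OF ab(1) half[OF ab(3)]] i[THEN conjunct2] using i[THEN conjunct1] by simp
  next
    assume ab: "-1 < \<alpha>" "\<alpha> < -1/2" "-1 < \<beta>" "\<beta> < -1/2"
    note i = term_both[OF ab, unfolded iff]
      term_sin[OF sf_half hm_half ab(1,2,3), unfolded iff]
      term_cos[OF sf_half hm_half ab(1,3,4), unfolded iff]
      term0[OF sf_half sf_half hm_half hm_half, unfolded iff]
    show "integrable (leb_I \<Otimes>\<^sub>M leb_I) (\<lambda>(u, v). (\<alpha> + \<beta> + 5/2) * (\<alpha> + \<beta> + 7/2) * sin \<theta> * sin \<phi>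
                  * Phi (2 * int n - 2) (\<alpha> + \<beta> + 5/2) \<theta> \<phi> u v * Pi_fun \<alpha> u * Pi_fun \<beta> v) \<and>
           integrable (leb_I \<Otimes>\<^sub>M dPi (-1/2)) (\<lambda>(u, v). -2 * (\<alpha> + \<beta> + 5/2) * sin (\<theta>/2) * sin (\<phi>/2)
                  * Phi (2 * int n - 1) (\<alpha> + \<beta> + 3/2) \<theta> \<phi> u v * Pi_fun \<alpha> u) \<and>
           integrable (dPi (-1/2) \<Otimes>\<^sub>M leb_I) (\<lambda>(u, v). -2 * (\<alpha> + \<beta> + 5/2) * cos (\<theta>/2) * cos (\<phi>/2)
                  * Phi (2 * int n - 1) (\<alpha> + \<beta> + 3/2) \<theta> \<phi> u v * Pi_fun \<beta> v) \<and>
           integrable (dPi (-1/2) \<Otimes>\<^sub>M dPi (-1/2)) (\<lambda>(u, v). Phi (2 * int n) (\<alpha> + \<beta> + 1/2) \<theta> \<phi> u v) \<and>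
           ?PP = (\<integral>z. (case z of (u, v) \<Rightarrow> (\<alpha> + \<beta> + 5/2) * (\<alpha> + \<beta> + 7/2) * sin \<theta> * sin \<phi>
                  * Phi (2 * int n - 2) (\<alpha> + \<beta> + 5/2) \<theta> \<phi> u v * Pi_fun \<alpha> u * Pi_fun \<beta> v) \<partial>(leb_I \<Otimes>\<^sub>M leb_I))
             + (\<integral>z. (case z of (u, v) \<Rightarrow> -2 * (\<alpha> + \<beta> + 5/2) * sin (\<theta>/2) * sin (\<phi>/2)
                  * Phi (2 * int n - 1) (\<alpha> + \<beta> + 3/2) \<theta> \<phi> u v * Pi_fun \<alpha> u) \<partial>(leb_I \<Otimes>\<^sub>M dPi (-1/2)))
             + (\<integral>z. (case z of (u, v) \<Rightarrow> -2 * (\<alpha> + \<beta> + 5/2) * cos (\<theta>/2) * cos (\<phi>/2)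
                  * Phi (2 * int n - 1) (\<alpha> + \<beta> + 3/2) \<theta> \<phi> u v * Pi_fun \<beta> v) \<partial>(dPi (-1/2) \<Otimes>\<^sub>M leb_I))
             + (\<integral>z. (case z of (u, v) \<Rightarrow> Phi (2 * int n) (\<alpha> + \<beta> + 1/2) \<theta> \<phi> u v) \<partial>(dPi (-1/2) \<Otimes>\<^sub>M dPi (-1/2)))"
      unfolding product[OF ab(1,3)] i[THEN conjunct2] using i[THEN conjunct1] by simp
  qed
qed

end
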